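(* Let $\mathfrak{v}=\mathfrak{v}_{(\psi,Q,\gamma)}$ with $Q=Q_j\in L\setminus L^\circ$. Then the value semigroup $S(R_X,\mathfrak{v})$ is the image of $$\Big\{(u,v)\in(\sigma^\vee\cap M)\times\mathbb{Z}\ \Big|\ -\lfloor\Delta_j(u)\rfloor\le v\le\sum_{i\ne j}\lfloor\Delta_i(u)\rfloor\Big\}$$ under the map $\rho:M\times\mathbb{Z}\to\Gamma$ given by $(u,\lambda)\mapsto\psi(u)+\lambda\cdot\gamma$. In particular, if $\mathfrak{v}$ has full rank, then $S(R_X,\mathfrak{v})$ is isomorphic to the semigroup displayed above.
   Context: $\mathbb{K}$ is an algebraically closed field; $T$ is an algebraic torus with character lattice $M$ and cocharacter lattice $N$. Let $m\ge1$, $\sigma\subset N_\mathbb{Q}$ a pointed polyhedral cone, and $\Delta_0,\dots,\Delta_m$ each either empty or a polyhedron in $N_\mathbb{Q}$ with tailcone $\{v:\Delta_i+v\subseteq\Delta_i\}=\sigma$, with $\sum_i\Delta_i\subsetneq\sigma$. For $u\in\sigma^\vee$, $\Delta_i(u)=\min_{v\in\Delta_i}\langle v,u\rangle$, and $\Delta_i(u)=\infty$ if $\Delta_i=\emptyset$ (a coefficient $\infty$ in a divisor allows poles of arbitrary order, and inequalities involving $\infty$ are vacuous). Let $L\subset\mathbb{P}^m=\mathrm{Proj}\,\mathbb{K}[y_0,\dots,y_m]$ be a line meeting the dense torus $(\mathbb{K}^* )^m$, $L^\circ=L\cap(\mathbb{K}^* )^m$, and let $Q_i$ be the point $V(y_i)\cap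 L$; the points $Q_0,\dots,Q_m$ are pairwise distinct. Let $X=X(L)=\mathrm{Spec}\,R_X$ with $$R_X=A(L)=\bigoplus_{u\in\sigma^\vee\cap M}H^0\Big(L,\mathcal{O}\big(\textstyle\sum_i\lfloor\Delta_i(u)\rfloor Q_i\big)\Big)\cdot\chi^u,$$ an affine rational complexity-one $T$-variety. Let $\Gamma$ be a totally ordered finitely generated free abelian group, $\psi:M\to\Gamma$ a homomorphism, $Q\in L$ a point, $\gamma\in\Gamma$ with $\gamma\ge0$. The valuation $\mathfrak{v}_{(\psi,Q,\gamma)}:R_X\setminus\{0\}\to\Gamma$ is given on homogeneous elements by $f\cdot\chi^u\mapsto\psi(u)+\mathrm{ord}_Q(f)\cdot\gamma$ ($f\in\mathbb{K}(L)^*$, $u\in M$), and on general elements by the minimum of its values on the nonzero homogeneous components. $S(R_X,\mathfrak{v})\subset\Gamma$ denotes its image; $\mathfrak{v}$ has full rank if the rank of the group generated by $S(R_X,\mathfrak{v})$ equals $\dim R_X$. *)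

theory Defs
  imports
    Complex_Main
    "HOL-Library.Extended"
    "HOL-Library.Extended_Nat"
    "HOL-Library.Poly_Mapping"
    "HOL-Library.Product_Plus"
    "HOL-Computational_Algebra.Polynomial"
    "HOL-Computational_Algebra.Fraction_Field"
    "HOL-Algebra.Ideal"
begin

section \<open>Abelian groups as \<open>\<int>\<close>-modules\<close>

definition zmul :: "int \<Rightarrow> 'a::ab_group_add \<Rightarrow> 'a" where
  "zmul k x = (\<Sum>i<nat k. x) - (\<Sum>i<nat (- k). x)"

text \<open>The following three lemmas justify the use of the library's \<open>module.span\<close> (here: the
  generated subgroup) and \<open>module.dependent\<close> for \<open>zmul\<close>.\<close>

lemma zmul_diff_nat: "zmul (int a - int b) x = (\<Sum>i<a. x) - (\<Sum>i<b. x)"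
proof (cases "a \<ge> b")
  case True
  then obtain c where a: "a = b + c" using le_Suc_ex by blast
  have "(\<Sum>i<b + c. x) = (\<Sum>i<b. x) + (\<Sum>i<c. x)" by (induction c) (auto simp: algebra_simps)
  then show ?thesis by (simp add: zmul_def a)
next
  case False
  then obtain c where b: "b = a + c" using le_Suc_ex nat_le_linear by blast
  have "(\<Sum>i<a + c. x) = (\<Sum>i<a. x) + (\<Sum>i<c. x)" by (induction c) (auto simp: algebra_simps)
  then show ?thesis by (simp add: zmul_def b)
qed

lemma zmul_add_left: "zmul (k + l) x = zmul k x + zmul l (x :: 'a::ab_group_add)"
proof -
  obtain a b where k: "k = int a - int b" using int_diff_cases by blast
  obtain c d where l: "l = int c - int d" using int_diff_cases by blast
  have kl: "k + l = int (a + c) - int (b + d)" using k l by simp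
  have s: "(\<Sum>i<m + n. x) = (\<Sum>i<m. x) + (\<Sum>i<n. x)" for m n :: nat
    by (induction n) (auto simp: algebra_simps)
  show ?thesis unfolding kl zmul_diff_nat unfolding k l zmul_diff_nat s by (simp add: algebra_simps)
qed

lemma module_zmul: "module (zmul :: int \<Rightarrow> 'a::ab_group_add \<Rightarrow> 'a)"
proof
  show add_right: "zmul k (x + y) = zmul k x + zmul k (y::'a)" for k x y
    by (simp add: zmul_def sum.distrib algebra_simps)
  show "zmul (k + l) x = zmul k x + zmul l (x::'a)" for k l x by (rule zmul_add_left)
  have zero: "zmul 0 x = 0" and one: "zmul 1 x = x" for x :: 'a by (simp_all add: zmul_def)
  show "zmul 1 x = x" for x :: 'a by (rule one)
  have pos: "zmul k (zmul l x) = zmul (k * l) x" if "k \<ge> 0" for k l and x :: 'a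
    using that by (induction k rule: int_ge_induct) (auto simp: zero one zmul_add_left algebra_simps)
  have neg: "zmul (- k) x = - zmul k x" for k and x :: 'a by (simp add: zmul_def)
  show "zmul k (zmul l x) = zmul (k * l) (x::'a)" for k l x
  proof (cases "k \<ge> 0")
    case False
    then show ?thesis using pos[of "- k" l x] by (simp add: neg)
  qed (rule pos)
qed

text \<open>\<open>fg_free TYPE('a)\<close>: the type \<open>'a\<close> is a finitely generated free abelian group.\<close>

definition fg_free :: "'a::ab_group_add itself \<Rightarrow> bool" where
  "fg_free _ \<longleftrightarrow> (\<exists>B :: 'a set. finite B \<and> \<not> module.dependent zmul B \<and> module.span zmul B = UNIV)"

definition group_rank :: "'a::ab_group_add set \<Rightarrow> enat" where
  "group_rank H = Sup {enat (card B) | B. finite B \<and> B \<subseteq> H \<and> \<not> module.dependent zmul B}"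

definition add_monoid_on :: "'a::monoid_add set \<Rightarrow> 'a monoid" where
  "add_monoid_on A = \<lparr>carrier = A, mult = (+), one = 0\<rparr>"


section \<open>Polyhedral geometry in \<open>N\<^sub>\<rat>\<close>\<close>

text \<open>The character lattice \<open>M\<close> is the type \<open>'m\<close>. Since \<open>N = Hom(M, \<int>)\<close>, the space
  \<open>N\<^sub>\<rat>\<close> is \<open>Hom(M, \<rat>)\<close>, and the pairing of \<open>v\<close> and \<open>u\<close> is \<open>v u\<close>. Clearing denominators, every rational
  half-space of \<open>N\<^sub>\<rat>\<close> has a normal vector in \<open>M\<close>.\<close>

definition NQ :: "('m::ab_group_add \<Rightarrow> rat) set" where
  "NQ = {v. additive v}"

definition polyhedron_in_NQ :: "('m::ab_group_add \<Rightarrow> rat) set \<Rightarrow> bool" where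
  "polyhedron_in_NQ D \<longleftrightarrow> (\<exists>F :: ('m \<times> rat) set. finite F \<and> D = {v \<in> NQ. \<forall>(u, a) \<in> F. a \<le> v u})"

definition polyhedral_cone :: "('m::ab_group_add \<Rightarrow> rat) set \<Rightarrow> bool" where
  "polyhedral_cone C \<longleftrightarrow> (\<exists>F :: 'm set. finite F \<and> C = {v \<in> NQ. \<forall>u \<in> F. 0 \<le> v u})"

definition pointed :: "('m::ab_group_add \<Rightarrow> rat) set \<Rightarrow> bool" where
  "pointed C \<longleftrightarrow> (\<forall>v. v \<in> C \<and> (\<lambda>u. - v u) \<in> C \<longrightarrow> v = (\<lambda>u. 0))"

definition tailcone :: "('m::ab_group_add \<Rightarrow> rat) set \<Rightarrow> ('m \<Rightarrow> rat) set" where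
  "tailcone D = {v \<in> NQ. \<forall>w \<in> D. (\<lambda>u. w u + v u) \<in> D}"

definition minkowski_sum :: "nat \<Rightarrow> (nat \<Rightarrow> ('m::ab_group_add \<Rightarrow> rat) set) \<Rightarrow> ('m \<Rightarrow> rat) set" where
  "minkowski_sum m \<Delta> = {\<lambda>u. \<Sum>i\<le>m. v i u | v. \<forall>i\<le>m. v i \<in> \<Delta> i}"

text \<open>The lattice points \<open>\<sigma>\<^sup>\<or> \<inter> M\<close> of the dual cone.\<close>

definition dual_lattice_points :: "('m::ab_group_add \<Rightarrow> rat) set \<Rightarrow> 'm set" where
  "dual_lattice_points \<sigma> = {u. \<forall>v \<in> \<sigma>. 0 \<le> v u}"

text \<open>\<open>\<Delta>(u)\<close>; the minimum exists for polyhedra with tailcone \<open>\<sigma>\<close> and \<open>u \<in> \<sigma>\<^sup>\<or>\<close>.\<close>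

definition min_on :: "('m::ab_group_add \<Rightarrow> rat) set \<Rightarrow> 'm \<Rightarrow> rat extended" where
  "min_on D u = (if D = {} then Pinf else Fin (LEAST r. r \<in> (\<lambda>v. v u) ` D))"

definition floor_min :: "('m::ab_group_add \<Rightarrow> rat) set \<Rightarrow> 'm \<Rightarrow> int extended" where
  "floor_min D u = map_extended floor (min_on D u)"


section \<open>Lines in projective space\<close>

text \<open>A vector \<open>x \<in> K\<^bsup>m+1\<^esup>\<close> is a function vanishing outside \<open>{0..m}\<close>; the point of \<open>P\<^sup>m\<close> with
  homogeneous coordinates \<open>x\<close> is the set of nonzero multiples of \<open>x\<close>.\<close>

definition coord_vecs :: "nat \<Rightarrow> (nat \<Rightarrow> 'k::field) set" where
  "coord_vecs m = {x. \<forall>i>m. x i = 0}"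

definition proj_pt :: "(nat \<Rightarrow> 'k::field) \<Rightarrow> (nat \<Rightarrow> 'k) set" where
  "proj_pt x = {\<lambda>i. c * x i | c. c \<noteq> 0}"

definition hyperplane :: "nat \<Rightarrow> nat \<Rightarrow> (nat \<Rightarrow> 'k::field) set set" where
  "hyperplane m i = {proj_pt x | x. x \<in> coord_vecs m \<and> x \<noteq> (\<lambda>_. 0) \<and> x i = 0}"

definition dense_torus :: "nat \<Rightarrow> (nat \<Rightarrow> 'k::field) set set" where
  "dense_torus m = {proj_pt x | x. x \<in> coord_vecs m \<and> (\<forall>i\<le>m. x i \<noteq> 0)}"

definition spans_line :: "nat \<Rightarrow> (nat \<Rightarrow> 'k::field) \<Rightarrow> (nat \<Rightarrow> 'k) \<Rightarrow> bool" where
  "spans_line m p q \<longleftrightarrow> p \<in> coord_vecs m \<and> q \<in> coord_vecs m \<and>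
     (\<forall>a b. (\<lambda>i. a * p i + b * q i) = (\<lambda>_. 0) \<longrightarrow> a = 0 \<and> b = 0)"

definition proj_line :: "(nat \<Rightarrow> 'k::field) \<Rightarrow> (nat \<Rightarrow> 'k) \<Rightarrow> (nat \<Rightarrow> 'k) set set" where
  "proj_line p q = {proj_pt (\<lambda>i. a * p i + b * q i) | a b. (a, b) \<noteq> (0, 0)}"

text \<open>Let \<open>L\<close> be the line spanned by \<open>p\<close> and \<open>q\<close>. Its function field \<open>K(L)\<close> is written as
  \<open>K(t) = 'k poly fract\<close>, where \<open>t\<close> is the coordinate of \<open>L\<close> taking the value \<open>c\<close> at \<open>[p + c q]\<close>
  and \<open>\<infinity>\<close> at \<open>[q]\<close>.\<close>

definition ord_at :: "'k::field \<Rightarrow> 'k poly fract \<Rightarrow> int" where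
  "ord_at c f = (THE n. \<exists>a b. a \<noteq> 0 \<and> b \<noteq> 0 \<and> f = Fract a b \<and>
     n = int (Polynomial.order c a) - int (Polynomial.order c b))"

definition ord_infinity :: "'k::field poly fract \<Rightarrow> int" where
  "ord_infinity f = (THE n. \<exists>a b. a \<noteq> 0 \<and> b \<noteq> 0 \<and> f = Fract a b \<and>
     n = int (degree b) - int (degree a))"

definition line_ord ::
  "(nat \<Rightarrow> 'k::field) \<Rightarrow> (nat \<Rightarrow> 'k) \<Rightarrow> (nat \<Rightarrow> 'k) set \<Rightarrow> 'k poly fract \<Rightarrow> int" where
  "line_ord p q P f = (if P = proj_pt q then ord_infinity f
     else ord_at (THE c. P = proj_pt (\<lambda>i. p i + c * q i)) f)"

text \<open>Global sections of \<open>\<O>(D)\<close> on \<open>L\<close>, where \<open>D\<close> maps each point of \<open>L\<close> to its coefficient. A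
  coefficient \<open>Pinf\<close> imposes no condition.\<close>

definition global_sections ::
  "(nat \<Rightarrow> 'k::field) \<Rightarrow> (nat \<Rightarrow> 'k) \<Rightarrow> ((nat \<Rightarrow> 'k) set \<Rightarrow> int extended) \<Rightarrow> 'k poly fract set" where
  "global_sections p q D =
     {f. f = 0 \<or> (\<forall>P \<in> proj_line p q. 0 \<le> Fin (line_ord p q P f) + D P)}"


section \<open>The algebra, its valuations and its dimension\<close>

text \<open>The divisor with coefficient \<open>\<lfloor>\<Delta>\<^sub>i(u)\<rfloor>\<close> at \<open>Q\<^sub>i\<close>, for \<open>i = 0, \<dots>, m\<close>.\<close>

definition poly_divisor :: "nat \<Rightarrow> (nat \<Rightarrow> ('m::ab_group_add \<Rightarrow> rat) set) \<Rightarrow>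
    (nat \<Rightarrow> 'p) \<Rightarrow> 'm \<Rightarrow> 'p \<Rightarrow> int extended" where
  "poly_divisor m \<Delta> Q u P = (\<Sum>i\<in>{i. i \<le> m \<and> Q i = P}. floor_min (\<Delta> i) u)"

text \<open>\<open>R\<^sub>X = A(L)\<close> inside the group algebra \<open>K(L)[M]\<close>, which is \<open>'m \<Rightarrow>\<^sub>0 'k poly fract\<close> with its
  convolution product.\<close>

definition RX :: "nat \<Rightarrow> ('m::ab_group_add \<Rightarrow> rat) set \<Rightarrow> (nat \<Rightarrow> ('m \<Rightarrow> rat) set) \<Rightarrow>
    (nat \<Rightarrow> 'k::field) \<Rightarrow> (nat \<Rightarrow> 'k) \<Rightarrow> (nat \<Rightarrow> (nat \<Rightarrow> 'k) set) \<Rightarrow> ('m \<Rightarrow>\<^sub>0 'k poly fract) set" where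
  "RX m \<sigma> \<Delta> p q Q =
     {f. \<forall>u \<in> Poly_Mapping.keys f. u \<in> dual_lattice_points \<sigma> \<and>
           Poly_Mapping.lookup f u \<in> global_sections p q (poly_divisor m \<Delta> Q u)}"

definition subring_of_type :: "'a::comm_ring_1 set \<Rightarrow> 'a ring" where
  "subring_of_type A = \<lparr>carrier = A, mult = (*), one = 1, zero = 0, add = (+)\<rparr>"

definition krull_dim :: "'a ring \<Rightarrow> enat" where
  "krull_dim R = Sup {enat n | n. \<exists>P. (\<forall>i\<le>n. primeideal (P i) R) \<and> (\<forall>i<n. P i \<subset> P (Suc i))}"

text \<open>The valuation \<open>v(\<psi>, P, \<gamma>)\<close>, for \<open>f \<noteq> 0\<close>.\<close>

definition val :: "(nat \<Rightarrow> 'k::field) \<Rightarrow> (nat \<Rightarrow> 'k) \<Rightarrow>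
    ('m::ab_group_add \<Rightarrow> 'g::linordered_ab_group_add) \<Rightarrow> (nat \<Rightarrow> 'k) set \<Rightarrow> 'g \<Rightarrow>
    ('m \<Rightarrow>\<^sub>0 'k poly fract) \<Rightarrow> 'g" where
  "val p q \<psi> P \<gamma> f = Min ((\<lambda>u. \<psi> u + zmul (line_ord p q P (Poly_Mapping.lookup f u)) \<gamma>) ` Poly_Mapping.keys f)"

definition value_semigroup :: "'a::zero set \<Rightarrow> ('a \<Rightarrow> 'g) \<Rightarrow> 'g set" where
  "value_semigroup R v = v ` (R - {0})"

definition full_rank :: "'a::comm_ring_1 set \<Rightarrow> ('a \<Rightarrow> 'g::ab_group_add) \<Rightarrow> bool" where
  "full_rank R v \<longleftrightarrow>
     group_rank (module.span zmul (value_semigroup R v)) = krull_dim (subring_of_type R)"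

text \<open>The semigroup of pairs \<open>(u, v)\<close> with \<open>u \<in> \<sigma>\<^sup>\<or> \<inter> M\<close> and
  \<open>- \<lfloor>\<Delta>\<^sub>j(u)\<rfloor> \<le> v \<le> \<Sum>\<^bsub>i \<noteq> j\<^esub> \<lfloor>\<Delta>\<^sub>i(u)\<rfloor>\<close>.\<close>

definition weight_semigroup :: "nat \<Rightarrow> ('m::ab_group_add \<Rightarrow> rat) set \<Rightarrow>
    (nat \<Rightarrow> ('m \<Rightarrow> rat) set) \<Rightarrow> nat \<Rightarrow> ('m \<times> int) set" where
  "weight_semigroup m \<sigma> \<Delta> j =
     {(u, v). u \<in> dual_lattice_points \<sigma> \<and> - floor_min (\<Delta> j) u \<le> Fin v \<and>
        Fin v \<le> (\<Sum>i\<in>{..m} - {j}. floor_min (\<Delta> i) u)}"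

end

theory Submission
  imports Defs "HOL-Library.Function_Algebras"
begin

text \<open>
  The valuation of an element of \<open>A(L)\<close> is attained on a homogeneous component, so only the orders at \<open>Q\<^sub>j\<close>
  of the nonzero sections \<open>f\<close> of weight \<open>u\<close> matter. Such an order is at least \<open>- \<lfloor>\<Delta>\<^sub>j(u)\<rfloor>\<close>, and it is at most
  \<open>\<Sum>\<^bsub>i \<noteq> j\<^esub> \<lfloor>\<Delta>\<^sub>i(u)\<rfloor>\<close> because \<open>f\<close> has as many zeros as poles (\<open>section_weight\<close>). Since every divisor of
  degree zero on a line is principal, all orders in between occur (\<open>weight_section\<close>). This computes the value
  semigroup as the image \<open>\<rho>(W)\<close> of the displayed semigroup \<open>W\<close>.

  For the isomorphism, \<open>\<rho>\<close> has to be injective on \<open>W\<close> if the rank of the group generated by \<open>\<rho>(W)\<close> is the Krull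
  dimension of \<open>A(L)\<close>. A nonzero difference of elements of \<open>W\<close> in the kernel of \<open>\<rho>\<close> would make this rank smaller than that
  of \<open>W\<close> (\<open>group_rank_image_less\<close>). So it suffices that the rank of \<open>W\<close> is at most the Krull dimension.
  This lower bound for the dimension comes from an explicit chain of primes (\<open>krull_dim_A_ge\<close>):
  evaluate sections at a general point of \<open>L\<close>, then set a basis of characters equal to \<open>1\<close> one by one. Each of these maps has values in a group algebra of an ordered group, which is a domain.

  That \<open>A(L)\<close> is a ring and \<open>W\<close> a monoid rests on the superadditivity of \<open>u \<mapsto> \<lfloor>\<Delta>\<^sub>i(u)\<rfloor>\<close>, and hence on the fact
  that an element of the dual of the tail cone attains its minimum on the polyhedron (\<open>min_on_attained\<close>).
\<close>

section \<open>Orders of rational functions\<close>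

lemma ord_at_Fract:
  fixes a b :: "'k::field poly"
  assumes "a \<noteq> 0" "b \<noteq> 0"
  shows "ord_at c (Fract a b) = int (Polynomial.order c a) - int (Polynomial.order c b)"
  unfolding ord_at_def
proof (rule the_equality)
  fix n assume "\<exists>a' b'. a' \<noteq> 0 \<and> b' \<noteq> 0 \<and> Fract a b = Fract a' b' \<and>
    n = int (Polynomial.order c a') - int (Polynomial.order c b')"
  then obtain a' b' where ab: "a' \<noteq> 0" "b' \<noteq> 0" "Fract a b = Fract a' b'"
    "n = int (Polynomial.order c a') - int (Polynomial.order c b')" by blast
  then have "a * b' = a' * b" using assms by (simp add: eq_fract)
  moreover have "Polynomial.order c (a * b') = Polynomial.order c a + Polynomial.order c b'"
    "Polynomial.order c (a' * b) = Polynomial.order c a' + Polynomial.order c b"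
    using ab assms by (simp_all add: order_mult)
  ultimately show "n = int (Polynomial.order c a) - int (Polynomial.order c b)" using ab by simp
qed (use assms in blast)

lemma ord_infinity_Fract:
  fixes a b :: "'k::field poly"
  assumes "a \<noteq> 0" "b \<noteq> 0"
  shows "ord_infinity (Fract a b) = int (degree b) - int (degree a)"
  unfolding ord_infinity_def
proof (rule the_equality)
  fix n assume "\<exists>a' b'. a' \<noteq> 0 \<and> b' \<noteq> 0 \<and> Fract a b = Fract a' b' \<and>
    n = int (degree b') - int (degree a')"
  then obtain a' b' where ab: "a' \<noteq> 0" "b' \<noteq> 0" "Fract a b = Fract a' b'"
    "n = int (degree b') - int (degree a')" by blast
  then have "a * b' = a' * b" using assms by (simp add: eq_fract)
  moreover have "degree (a * b') = degree a + degree b'" "degree (a' * b) = degree a' + degree b"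
    using ab assms by (simp_all add: degree_mult_eq)
  ultimately show "n = int (degree b) - int (degree a)" using ab by simp
qed (use assms in blast)

lemma Fract_nonzeroE:
  assumes "(f :: 'k::field poly fract) \<noteq> 0"
  obtains a b where "a \<noteq> 0" "b \<noteq> 0" "f = Fract a b"
  using assms by (cases f rule: Fract_cases_nonzero) auto

text \<open>The order at a finite point and the order at infinity are defined differently. Both are discrete valuations,
  and sections are handled through this common structure.\<close>

locale discrete_valuation =
  fixes w :: "'f::field \<Rightarrow> int"
  assumes val_mult: "f \<noteq> 0 \<Longrightarrow> g \<noteq> 0 \<Longrightarrow> w (f * g) = w f + w g"
    and val_add: "f \<noteq> 0 \<Longrightarrow> g \<noteq> 0 \<Longrightarrow> f + g \<noteq> 0 \<Longrightarrow> min (w f) (w g) \<le> w (f + g)"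
begin

lemma val_one: "w 1 = 0"
  using val_mult[of 1 1] by simp

lemma val_power: "f \<noteq> 0 \<Longrightarrow> w (f ^ n) = int n * w f"
  by (induction n) (auto simp: val_one val_mult algebra_simps)

lemma val_inverse: "f \<noteq> 0 \<Longrightarrow> w (inverse f) = - w f"
  using val_mult[of f "inverse f"] val_one by simp

lemma val_power_int: "f \<noteq> 0 \<Longrightarrow> w (f powi n) = n * w f"
  by (cases "n \<ge> 0") (auto simp: power_int_def val_power val_inverse)

lemma val_prod: "(\<And>x. x \<in> S \<Longrightarrow> f x \<noteq> 0) \<Longrightarrow> w (\<Prod>x\<in>S. f x) = (\<Sum>x\<in>S. w (f x))"
  by (induction S rule: infinite_finite_induct) (auto simp: val_one val_mult)

end

lemma discrete_valuation_ord_at: "discrete_valuation (ord_at (c :: 'k::field))"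
proof
  fix f g :: "'k poly fract" assume "f \<noteq> 0" "g \<noteq> 0"
  then obtain a b a' b' where ab: "a \<noteq> 0" "b \<noteq> 0" "f = Fract a b" "a' \<noteq> 0" "b' \<noteq> 0" "g = Fract a' b'"
    by (metis Fract_nonzeroE)
  show "ord_at c (f * g) = ord_at c f + ord_at c g"
    using ab by (simp add: ord_at_Fract order_mult)
  assume nz: "f + g \<noteq> 0"
  have fg: "f + g = Fract (a * b' + a' * b) (b * b')" using ab by simp
  have s: "a * b' + a' * b \<noteq> 0" using nz unfolding fg by (auto simp: fract_collapse)
  define n where "n = min (Polynomial.order c (a * b')) (Polynomial.order c (a' * b))"
  have "[:-c, 1:] ^ n dvd a * b'" "[:-c, 1:] ^ n dvd a' * b"
    by (simp_all add: order_divides n_def)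
  then have "[:-c, 1:] ^ n dvd a * b' + a' * b" by (rule dvd_add)
  then have "n \<le> Polynomial.order c (a * b' + a' * b)" using s by (simp add: order_divides)
  then show "min (ord_at c f) (ord_at c g) \<le> ord_at c (f + g)"
    unfolding fg using ab s by (auto simp: ord_at_Fract order_mult n_def)
qed

lemma discrete_valuation_ord_infinity: "discrete_valuation (ord_infinity :: 'k::field poly fract \<Rightarrow> int)"
proof
  fix f g :: "'k poly fract" assume "f \<noteq> 0" "g \<noteq> 0"
  then obtain a b a' b' where ab: "a \<noteq> 0" "b \<noteq> 0" "f = Fract a b" "a' \<noteq> 0" "b' \<noteq> 0" "g = Fract a' b'"
    by (metis Fract_nonzeroE)
  show "ord_infinity (f * g) = ord_infinity f + ord_infinity g"
    using ab by (simp add: ord_infinity_Fract degree_mult_eq)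
  assume nz: "f + g \<noteq> 0"
  have fg: "f + g = Fract (a * b' + a' * b) (b * b')" using ab by simp
  have s: "a * b' + a' * b \<noteq> 0" using nz unfolding fg by (auto simp: fract_collapse)
  have "degree (a * b' + a' * b) \<le> max (degree (a * b')) (degree (a' * b))"
    by (rule degree_add_le_max)
  then show "min (ord_infinity f) (ord_infinity g) \<le> ord_infinity (f + g)"
    unfolding fg using ab s by (auto simp: ord_infinity_Fract degree_mult_eq)
qed

lemma discrete_valuation_line_ord: "discrete_valuation (line_ord p q P)"
proof (cases "P = proj_pt q")
  case True
  then have "line_ord p q P = ord_infinity" by (auto simp: line_ord_def)
  then show ?thesis using discrete_valuation_ord_infinity by metis
next
  case False
  then have "line_ord p q P = ord_at (THE c. P = proj_pt (\<lambda>i. p i + c * q i))"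
    by (auto simp: line_ord_def)
  then show ?thesis using discrete_valuation_ord_at by metis
qed

lemma order_linear: "Polynomial.order c [:- d, 1::'k::field:] = (if c = d then 1 else 0)"
  using order_power_n_n[of d 1] by (auto simp: order_0I)

lemma sum_order_eq_degree:
  fixes a :: "'k::alg_closed_field poly"
  assumes "a \<noteq> 0" "finite S" "\<And>c. poly a c = 0 \<Longrightarrow> c \<in> S"
  shows "(\<Sum>c\<in>S. Polynomial.order c a) = degree a"
  using assms
proof (induction "degree a" arbitrary: a)
  case 0
  then obtain k where "a = [:k:]" using degree_eq_zeroE by metis
  then show ?case using 0 by (auto simp: order_0I)
next
  case (Suc n)
  then obtain x where x: "poly a x = 0" using alg_closed_imp_poly_has_root by (metis zero_less_Suc)
  then obtain b where b: "a = [:-x, 1:] * b" using poly_eq_0_iff_dvd by (metis dvdE)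
  have b0: "b \<noteq> 0" using b Suc by auto
  have n: "n = degree b" using Suc.hyps(2) b b0 by (simp add: degree_mult_eq del: mult_pCons_left)
  have IH: "(\<Sum>c\<in>S. Polynomial.order c b) = degree b"
    using Suc.prems b0 n by (intro Suc.hyps) (auto simp: b)
  have "(\<Sum>c\<in>S. Polynomial.order c a) = (\<Sum>c\<in>S. (if c = x then 1 else 0) + Polynomial.order c b)"
    using Suc.prems(1) unfolding b by (intro sum.cong refl) (simp add: order_mult order_linear del: mult_pCons_left)
  also have "\<dots> = Suc (degree b)" using x Suc.prems by (simp add: sum.distrib IH)
  finally show ?case using n Suc.hyps(2) by simp
qed

text \<open>A principal divisor has degree zero: over an algebraically closed field the orders of a polynomial at its
  roots add up to its degree, and the order at infinity compensates. Leaving out points where the order is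
  nonnegative can only decrease the sum.\<close>

lemma degree_of_principal_le:
  fixes f :: "'k::alg_closed_field poly fract"
  assumes "f \<noteq> 0" "finite S" "\<And>c. c \<notin> S \<Longrightarrow> 0 \<le> ord_at c f"
  shows "(\<Sum>c\<in>S. ord_at c f) + ord_infinity f \<le> 0"
proof -
  obtain a b where ab: "a \<noteq> 0" "b \<noteq> 0" "f = Fract a b" using assms Fract_nonzeroE by metis
  define T where "T = S \<union> {c. poly a c = 0} \<union> {c. poly b c = 0}"
  have T: "finite T" using assms ab by (simp add: T_def poly_roots_finite)
  have "(\<Sum>c\<in>S. ord_at c f) \<le> (\<Sum>c\<in>T. ord_at c f)"
    by (rule sum_mono2) (use T assms in \<open>auto simp: T_def\<close>)
  also have "\<dots> = int (\<Sum>c\<in>T. Polynomial.order c a) - int (\<Sum>c\<in>T. Polynomial.order c b)"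
    using ab by (simp add: ord_at_Fract sum_subtractf)
  also have "(\<Sum>c\<in>T. Polynomial.order c a) = degree a"
    by (rule sum_order_eq_degree) (use ab T in \<open>auto simp: T_def\<close>)
  also have "(\<Sum>c\<in>T. Polynomial.order c b) = degree b"
    by (rule sum_order_eq_degree) (use ab T in \<open>auto simp: T_def\<close>)
  finally show ?thesis using ab by (simp add: ord_infinity_Fract)
qed


section \<open>Points and principal divisors of the line\<close>

definition line_pt :: "(nat \<Rightarrow> 'k::field) \<Rightarrow> (nat \<Rightarrow> 'k) \<Rightarrow> 'k \<Rightarrow> (nat \<Rightarrow> 'k) set" where
  "line_pt p q c = proj_pt (\<lambda>i. p i + c * q i)"

lemma proj_pt_self: "x \<in> proj_pt x"
  unfolding proj_pt_def by (rule CollectI, rule exI[of _ 1]) simp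

lemma proj_pt_scale:
  assumes "(k::'k::field) \<noteq> 0" shows "proj_pt (\<lambda>i. k * x i) = proj_pt x"
proof (intro Set.set_eqI iffI)
  fix y assume "y \<in> proj_pt (\<lambda>i. k * x i)"
  then obtain d where "d \<noteq> 0" "y = (\<lambda>i. (d * k) * x i)" by (auto simp: proj_pt_def mult.assoc)
  then show "y \<in> proj_pt x" using assms unfolding proj_pt_def by (intro CollectI exI[of _ "d * k"]) auto
next
  fix y assume "y \<in> proj_pt x"
  then obtain d where "d \<noteq> 0" "y = (\<lambda>i. d * x i)" by (auto simp: proj_pt_def)
  then show "y \<in> proj_pt (\<lambda>i. k * x i)"
    using assms unfolding proj_pt_def by (intro CollectI exI[of _ "d / k"]) auto
qed

text \<open>The next three lemmas identify the line with \<open>K \<union> {\<infinity>}\<close>, the point \<open>[q]\<close> being \<open>\<infinity>\<close>.\<close>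

lemma line_pt_inject:
  assumes "spans_line m p q"
  shows "line_pt p q c = line_pt p q d \<longleftrightarrow> c = d"
proof
  assume "line_pt p q c = line_pt p q d"
  then have "(\<lambda>i. p i + c * q i) \<in> line_pt p q d" using proj_pt_self unfolding line_pt_def by metis
  then obtain k where k: "(\<lambda>i. p i + c * q i) = (\<lambda>i. k * (p i + d * q i))"
    by (auto simp: line_pt_def proj_pt_def)
  have "(\<lambda>i. (1 - k) * p i + (c - k * d) * q i) = (\<lambda>_. 0)"
    using fun_cong[OF k] by (auto simp: algebra_simps)
  then have "1 - k = 0" "c - k * d = 0" using assms unfolding spans_line_def by blast+
  then show "c = d" by simp
qed simp

lemma line_pt_not_infinity:
  assumes "spans_line m p q"
  shows "line_pt p q c \<noteq> proj_pt q"
proof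
  assume "line_pt p q c = proj_pt q"
  then have "(\<lambda>i. p i + c * q i) \<in> proj_pt q" using proj_pt_self unfolding line_pt_def by metis
  then obtain k where k: "(\<lambda>i. p i + c * q i) = (\<lambda>i. k * q i)" by (auto simp: proj_pt_def)
  have "(\<lambda>i. 1 * p i + (c - k) * q i) = (\<lambda>_. 0)"
    using fun_cong[OF k] by (auto simp: algebra_simps)
  then have "(1::'a) = 0" using assms unfolding spans_line_def by blast
  then show False by simp
qed

lemma proj_line_points:
  "proj_line p q = insert (proj_pt q) (range (line_pt p q))"
proof (intro Set.set_eqI iffI)
  fix P assume "P \<in> proj_line p q"
  then obtain a b where ab: "P = proj_pt (\<lambda>i. a * p i + b * q i)" "(a, b) \<noteq> (0, 0)"
    by (auto simp: proj_line_def)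
  show "P \<in> insert (proj_pt q) (range (line_pt p q))"
  proof (cases "a = 0")
    case True
    then show ?thesis using ab proj_pt_scale[of b q] by simp
  next
    case False
    have "P = proj_pt (\<lambda>i. a * (p i + (b / a) * q i))" using ab False by (simp add: algebra_simps)
    then have "P = line_pt p q (b / a)"
      using proj_pt_scale[OF False, of "\<lambda>i. p i + (b / a) * q i"] by (simp add: line_pt_def)
    then show ?thesis by simp
  qed
next
  fix P assume "P \<in> insert (proj_pt q) (range (line_pt p q))"
  then consider "P = proj_pt (\<lambda>i. 0 * p i + 1 * q i)" | c where "P = proj_pt (\<lambda>i. 1 * p i + c * q i)"
    by (auto simp: line_pt_def)
  then show "P \<in> proj_line p q" unfolding proj_line_def by cases fastforce+
qed

lemma line_ord_infinity: "line_ord p q (proj_pt q) = ord_infinity"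
  by (auto simp: line_ord_def)

lemma line_ord_line_pt:
  assumes "spans_line m p q"
  shows "line_ord p q (line_pt p q c) = ord_at c"
proof -
  have "(THE d. line_pt p q c = proj_pt (\<lambda>i. p i + d * q i)) = c"
    using line_pt_inject[OF assms] by (intro the_equality) (auto simp flip: line_pt_def)
  then show ?thesis using line_pt_not_infinity[OF assms] by (auto simp: line_ord_def)
qed

lemma sum_points:
  assumes "spans_line m p q" "finite Z" "Z \<subseteq> proj_line p q"
  shows "sum h Z = (\<Sum>c\<in>{c. line_pt p q c \<in> Z}. h (line_pt p q c)) + (if proj_pt q \<in> Z then h (proj_pt q) else (0::int))"
    and "finite {c. line_pt p q c \<in> Z}"
proof -
  have inj: "inj (line_pt p q)" using line_pt_inject[OF assms(1)] by (auto intro: injI)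
  let ?C = "{c. line_pt p q c \<in> Z}"
  show fin: "finite ?C" using finite_vimageI[OF assms(2) inj] by (simp add: vimage_def)
  have Z: "Z = line_pt p q ` ?C \<union> (Z \<inter> {proj_pt q})" using assms(3) by (auto simp: proj_line_points)
  have "sum h Z = sum h (line_pt p q ` ?C) + sum h (Z \<inter> {proj_pt q})"
    by (subst Z, rule sum.union_disjoint) (use fin line_pt_not_infinity[OF assms(1)] in auto)
  then show "sum h Z = (\<Sum>c\<in>?C. h (line_pt p q c)) + (if proj_pt q \<in> Z then h (proj_pt q) else 0)"
    using inj by (simp add: sum.reindex inj_on_def)
qed

lemma sum_line_ord_le_0:
  fixes p q :: "nat \<Rightarrow> 'k::alg_closed_field"
  assumes "spans_line m p q" "finite Z" "Z \<subseteq> proj_line p q" "f \<noteq> 0"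
    and nonneg: "\<And>P. P \<in> proj_line p q - Z \<Longrightarrow> 0 \<le> line_ord p q P f"
  shows "(\<Sum>P\<in>Z. line_ord p q P f) \<le> 0"
proof -
  note [simp] = line_ord_line_pt[OF assms(1)] line_ord_infinity
  have "(\<Sum>c\<in>{c. line_pt p q c \<in> Z}. ord_at c f) + ord_infinity f \<le> 0"
  proof (rule degree_of_principal_le[OF assms(4) sum_points(2)[OF assms(1-3)]])
    fix c assume "c \<notin> {c. line_pt p q c \<in> Z}"
    then show "0 \<le> ord_at c f" using nonneg[of "line_pt p q c"] by (auto simp: proj_line_points)
  qed
  moreover have "proj_pt q \<notin> Z \<Longrightarrow> 0 \<le> ord_infinity f"
    using nonneg[of "proj_pt q"] by (auto simp: proj_line_points)
  ultimately show ?thesis using sum_points(1)[OF assms(1-3), of "\<lambda>P. line_ord p q P f"] by auto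
qed

text \<open>On a rational curve every divisor of degree zero is principal: take the product of the powers
  \<open>(t - c)\<^sup>n\<close> over its finite points. The order at infinity is then right because the total degree is zero.\<close>

lemma exists_principal_divisor:
  fixes p q :: "nat \<Rightarrow> 'k::field" and n :: "(nat \<Rightarrow> 'k) set \<Rightarrow> int"
  assumes "spans_line m p q" "finite Z" "Z \<subseteq> proj_line p q" "sum n Z = 0"
  obtains f where "f \<noteq> 0" "\<And>P. P \<in> Z \<Longrightarrow> line_ord p q P f = n P"
    "\<And>P. P \<in> proj_line p q - Z \<Longrightarrow> line_ord p q P f = 0"
proof
  note [simp] = line_ord_line_pt[OF assms(1)] line_ord_infinity
  define C where "C = {c. line_pt p q c \<in> Z}"
  define N where "N c = n (line_pt p q c)" for c
  have memC: "d \<in> C \<longleftrightarrow> line_pt p q d \<in> Z" for d by (simp add: C_def)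
  have C: "finite C" using sum_points(2)[OF assms(1-3)] by (simp add: C_def)
  have sumN: "(\<Sum>c\<in>C. N c) = (if proj_pt q \<in> Z then - n (proj_pt q) else 0)"
    using sum_points(1)[OF assms(1-3), of n] assms(4) by (simp add: C_def N_def split: if_splits)
  define lin where "lin c = Fract [:- c, 1::'k:] 1" for c
  have lin0: "lin c \<noteq> 0" for c by (simp add: lin_def Zero_fract_def eq_fract)
  define f where "f = (\<Prod>c\<in>C. lin c powi N c)"
  show "f \<noteq> 0" using C lin0 by (simp add: f_def power_int_eq_0_iff)
  have at: "ord_at d f = (if d \<in> C then N d else 0)" for d
  proof -
    interpret discrete_valuation "ord_at d" by (rule discrete_valuation_ord_at)
    have "ord_at d f = (\<Sum>c\<in>C. N c * ord_at d (lin c))"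
      unfolding f_def by (subst val_prod) (auto simp: val_power_int lin0 power_int_eq_0_iff)
    also have "\<dots> = (\<Sum>c\<in>C. if c = d then N d else 0)"
      by (rule sum.cong) (auto simp: lin_def ord_at_Fract order_linear)
    finally show ?thesis using C by simp
  qed
  have inf: "ord_infinity f = - (\<Sum>c\<in>C. N c)"
  proof -
    interpret discrete_valuation "ord_infinity :: 'k poly fract \<Rightarrow> int"
      by (rule discrete_valuation_ord_infinity)
    have "ord_infinity f = (\<Sum>c\<in>C. N c * ord_infinity (lin c))"
      unfolding f_def by (subst val_prod) (auto simp: val_power_int lin0 power_int_eq_0_iff)
    then show ?thesis by (simp add: lin_def ord_infinity_Fract sum_negf)
  qed
  show "line_ord p q P f = n P" if "P \<in> Z" for P
  proof -
    have "P \<in> proj_line p q" using that assms(3) by blast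
    then consider "P = proj_pt q" | d where "P = line_pt p q d" by (auto simp: proj_line_points)
    then show ?thesis using that sumN by cases (auto simp: at inf memC N_def)
  qed
  show "line_ord p q P f = 0" if "P \<in> proj_line p q - Z" for P
  proof -
    have "P \<in> proj_line p q" using that by blast
    then consider "P = proj_pt q" | d where "P = line_pt p q d" by (auto simp: proj_line_points)
    then show ?thesis using that sumN by cases (auto simp: at inf memC N_def)
  qed
qed

section \<open>Evaluation at a point of the line\<close>

text \<open>The local ring of the line at the point with parameter \<open>c\<close>; its nonzero elements are those of nonnegative order,
  by the criterion below.\<close>

definition regular_at :: "'k::field \<Rightarrow> 'k poly fract set" where
  "regular_at c = {Fract a b | a b. poly b c \<noteq> 0}"

definition ev_at :: "'k::field \<Rightarrow> 'k poly fract \<Rightarrow> 'k" where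
  "ev_at c f = (THE y. \<exists>a b. poly b c \<noteq> 0 \<and> f = Fract a b \<and> y = poly a c / poly b c)"

text \<open>The value of a fraction at \<open>c\<close> depends on the chosen representation only through the requirement that the
  denominator does not vanish at \<open>c\<close>.\<close>

lemma ev_at_Fract:
  assumes "poly b c \<noteq> 0"
  shows "ev_at c (Fract a b) = poly a c / poly b c"
  unfolding ev_at_def
proof (rule the_equality)
  fix y assume "\<exists>a' b'. poly b' c \<noteq> 0 \<and> Fract a b = Fract a' b' \<and> y = poly a' c / poly b' c"
  then obtain a' b' where ab: "poly b' c \<noteq> 0" "Fract a b = Fract a' b'" "y = poly a' c / poly b' c" by blast
  have "b \<noteq> 0" "b' \<noteq> 0" using assms ab by auto
  then have "a * b' = a' * b" using ab by (simp add: eq_fract)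
  then have "poly a c * poly b' c = poly a' c * poly b c" by (metis poly_mult)
  then show "y = poly a c / poly b c" using ab assms by (simp add: frac_eq_eq)
qed (use assms in blast)

lemma regular_at_iff:
  assumes "f \<noteq> 0"
  shows "f \<in> regular_at c \<longleftrightarrow> 0 \<le> ord_at c f"
proof
  assume "f \<in> regular_at c"
  then obtain a b where ab: "f = Fract a b" "poly b c \<noteq> 0" by (auto simp: regular_at_def)
  then have "b \<noteq> 0" "a \<noteq> 0" using assms by (auto simp: fract_collapse)
  then show "0 \<le> ord_at c f" using ab by (simp add: ord_at_Fract order_0I)
next
  assume pos: "0 \<le> ord_at c f"
  obtain a b where ab: "a \<noteq> 0" "b \<noteq> 0" "f = Fract a b" using assms Fract_nonzeroE by metis
  define k where "k = Polynomial.order c a"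
  define l where "l = Polynomial.order c b"
  have kl: "l \<le> k" using pos ab by (simp add: ord_at_Fract k_def l_def)
  obtain a' where a': "a = [:- c, 1:] ^ k * a'" using order_1[of c a] unfolding k_def by (metis dvdE)
  obtain b' where b': "b = [:- c, 1:] ^ l * b'" "\<not> [:- c, 1:] dvd b'"
    using order_decomp[OF ab(2), of c] unfolding l_def by metis
  have "a = [:- c, 1:] ^ l * ([:- c, 1:] ^ (k - l) * a')"
    unfolding a' mult.assoc[symmetric] power_add[symmetric] using kl by simp
  then have "f = Fract ([:- c, 1:] ^ (k - l) * a') b'"
    using ab b' mult_fract_cancel[of "[:- c, 1:] ^ l"] by simp
  moreover have "poly b' c \<noteq> 0" using b'(2) by (simp add: poly_eq_0_iff_dvd)
  ultimately show "f \<in> regular_at c" unfolding regular_at_def by blast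
qed

lemma regular_at_0: "0 \<in> regular_at c"
  unfolding regular_at_def Zero_fract_def using one_neq_zero poly_1 by fastforce

lemma ev_at_0: "ev_at c 0 = 0" and ev_at_1: "ev_at c 1 = 1"
  unfolding Zero_fract_def One_fract_def by (simp_all add: ev_at_Fract)

lemma
  assumes "f \<in> regular_at c" "g \<in> regular_at c"
  shows regular_at_add: "f + g \<in> regular_at c" and ev_at_add: "ev_at c (f + g) = ev_at c f + ev_at c g"
    and regular_at_mult: "f * g \<in> regular_at c" and ev_at_mult: "ev_at c (f * g) = ev_at c f * ev_at c g"
proof -
  obtain a b a' b' where ab: "f = Fract a b" "poly b c \<noteq> 0" "g = Fract a' b'" "poly b' c \<noteq> 0"
    using assms by (auto simp: regular_at_def)
  then have nz: "b \<noteq> 0" "b' \<noteq> 0" "poly (b * b') c \<noteq> 0" by auto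
  have s: "f + g = Fract (a * b' + a' * b) (b * b')" and pr: "f * g = Fract (a * a') (b * b')"
    using ab nz by simp_all
  show "f + g \<in> regular_at c" "f * g \<in> regular_at c" unfolding s pr regular_at_def using nz by blast+
  show "ev_at c (f + g) = ev_at c f + ev_at c g" unfolding s using ab nz
    by (simp add: ev_at_Fract field_simps)
  show "ev_at c (f * g) = ev_at c f * ev_at c g" unfolding pr using ab nz
    by (simp add: ev_at_Fract field_simps)
qed

lemma ev_at_nonzero:
  assumes "f \<noteq> 0" "ord_at c f = 0"
  shows "ev_at c f \<noteq> 0"
proof -
  interpret discrete_valuation "ord_at c" by (rule discrete_valuation_ord_at)
  have "f \<in> regular_at c" "inverse f \<in> regular_at c"
    using assms by (simp_all add: regular_at_iff val_inverse)
  then have "ev_at c f * ev_at c (inverse f) = 1"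
    using ev_at_mult[of f c "inverse f"] assms by (simp add: ev_at_1)
  then show ?thesis by auto
qed

definition const_fract :: "'k::field \<Rightarrow> 'k poly fract" where
  "const_fract k = Fract [:k:] 1"

lemma const_fract_0_iff: "const_fract k = 0 \<longleftrightarrow> k = 0"
  by (simp add: const_fract_def Zero_fract_def eq_fract)

lemma ev_at_const: "ev_at c (const_fract k) = k"
  by (simp add: const_fract_def ev_at_Fract)

lemma line_ord_const: "k \<noteq> 0 \<Longrightarrow> line_ord p q P (const_fract k) = 0"
  by (simp add: const_fract_def line_ord_def ord_infinity_Fract ord_at_Fract order_0I)

text \<open>An algebraically closed field is infinite: a root of \<open>1 + \<Prod> (X - x)\<close>, the product being over all \<open>x \<in> S\<close>,
  is not in \<open>S\<close>.\<close>

lemma exists_outside_finite: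
  assumes "finite (S :: 'k::alg_closed_field set)"
  obtains c where "c \<notin> S"
proof (cases "S = {}")
  case False
  define a where "a = (\<Prod>x\<in>S. [:- x, 1:])"
  have "degree a = card S" unfolding a_def by (subst degree_prod_eq_sum_degree) auto
  then have "degree (a + 1) > 0" using False assms
    by (metis card_gt_0_iff degree_1 degree_add_eq_left)
  then obtain c where c: "poly (a + 1) c = 0" using alg_closed_imp_poly_has_root by blast
  have "c \<notin> S"
  proof
    assume "c \<in> S"
    then have "poly a c = 0" using assms by (auto simp: a_def poly_prod)
    then show False using c by simp
  qed
  then show ?thesis using that by blast
qed (use that in blast)


section \<open>Minima of linear functions on polyhedra\<close>

lemma NQ_combine: "v \<in> NQ \<Longrightarrow> w \<in> NQ \<Longrightarrow> (\<lambda>u. v u + t * w u) \<in> NQ"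
  by (auto simp: NQ_def additive_def algebra_simps)

lemma NQ_scale:
  assumes "w \<in> NQ" shows "(\<lambda>u. t * w u) \<in> NQ"
  using assms by (auto simp: NQ_def additive_def algebra_simps)

text \<open>The minimum is found by an active-set argument. From a feasible point at which the
  objective \<open>u\<close> is not constant along the face of tight constraints, one can decrease \<open>u\<close> until a further
  constraint becomes tight. This ends at a point where \<open>u\<close> is determined by the set of tight constraints, and
  there are only finitely many such sets.\<close>

locale linear_program =
  fixes F :: "('m::ab_group_add \<times> rat) set" and u :: 'm
  assumes finite_F: "finite F"
    and nonneg_on_recession_cone:
      "\<And>w. w \<in> NQ \<Longrightarrow> (\<And>x a. (x, a) \<in> F \<Longrightarrow> 0 \<le> w x) \<Longrightarrow> 0 \<le> w u"
begin

definition feasible :: "('m \<Rightarrow> rat) set" where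
  "feasible = {v \<in> NQ. \<forall>(x, a) \<in> F. a \<le> v x}"

definition tight :: "('m \<Rightarrow> rat) \<Rightarrow> ('m \<times> rat) set" where
  "tight v = {(x, a) \<in> F. v x = a}"

definition basic :: "('m \<Rightarrow> rat) \<Rightarrow> bool" where
  "basic v \<longleftrightarrow> v \<in> feasible \<and> (\<forall>w \<in> NQ. (\<forall>(x, a) \<in> tight v. w x = 0) \<longrightarrow> w u = 0)"

text \<open>Some direction \<open>w\<close> preserves the tight constraints and decreases \<open>u\<close>. As \<open>w\<close> is not in the recession
  cone, moving along \<open>w\<close> eventually meets a new constraint; the ratio test finds the first one.\<close>

lemma improve:
  assumes v: "v \<in> feasible" and nb: "\<not> basic v"
  obtains v' where "v' \<in> feasible" "v' u \<le> v u" "tight v \<subset> tight v'"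
proof -
  obtain w0 where w0: "w0 \<in> NQ" "\<forall>(x, a) \<in> tight v. w0 x = 0" "w0 u \<noteq> 0"
    using assms unfolding basic_def by blast
  define w where "w = (\<lambda>x. (if w0 u < 0 then 1 else - 1) * w0 x)"
  have w: "w \<in> NQ" unfolding w_def by (rule NQ_scale[OF w0(1)])
  have w_tight: "w x = 0" if "(x, a) \<in> tight v" for x a using w0(2) that by (auto simp: w_def)
  have wu: "w u < 0" using w0(3) by (auto simp: w_def)
  define G where "G = {(x, a) \<in> F. w x < 0}"
  have G: "finite G" "G \<noteq> {}"
  proof -
    show "finite G" using finite_F by (rule finite_subset[rotated]) (auto simp: G_def)
    obtain x a where "(x, a) \<in> F" "\<not> 0 \<le> w x" using nonneg_on_recession_cone[OF w] wu by force
    then show "G \<noteq> {}" by (auto simp: G_def)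
  qed
  define ratio where "ratio = (\<lambda>(x, a). (v x - a) / (- w x))"
  define t where "t = Min (ratio ` G)"
  have t_le: "t \<le> ratio g" if "g \<in> G" for g using that G by (simp add: t_def)
  obtain x0 a0 where g0: "(x0, a0) \<in> G" "t = ratio (x0, a0)"
    using Min_in[of "ratio ` G"] G unfolding t_def by fastforce
  have vF: "a \<le> v x" if "(x, a) \<in> F" for x a using v that by (auto simp: feasible_def)
  have t0: "0 \<le> t" using g0 vF[of x0 a0] by (auto simp: G_def ratio_def divide_nonneg_neg)
  define v' where "v' = (\<lambda>x. v x + t * w x)"
  have "v' \<in> NQ" unfolding v'_def using NQ_combine v w by (auto simp: feasible_def)
  moreover have "a \<le> v' x" if xa: "(x, a) \<in> F" for x a
  proof (cases "w x < 0")
    case True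
    then have "t \<le> (v x - a) / (- w x)" using t_le[of "(x, a)"] xa by (simp add: G_def ratio_def)
    then have "t * (- w x) \<le> v x - a" using True by (subst (asm) pos_le_divide_eq) auto
    then show ?thesis by (simp add: v'_def)
  next
    case False
    then have "0 \<le> t * w x" using t0 by simp
    then show ?thesis using vF[OF xa] by (simp add: v'_def)
  qed
  ultimately have feas: "v' \<in> feasible" by (auto simp: feasible_def)
  have "v' u \<le> v u" using t0 wu by (simp add: v'_def mult_nonneg_nonpos)
  moreover have "tight v \<subseteq> tight v'" using w_tight by (auto simp: tight_def v'_def)
  moreover have "(x0, a0) \<in> tight v'" using g0 by (auto simp: tight_def v'_def G_def ratio_def field_simps)
  moreover have "(x0, a0) \<notin> tight v" using w_tight[of x0 a0] g0 by (auto simp: G_def)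
  ultimately show ?thesis using that[OF feas] by blast
qed

lemma dominated_by_basic:
  assumes "v \<in> feasible"
  shows "\<exists>v'. basic v' \<and> v' u \<le> v u"
  using assms
proof (induction "card (F - tight v)" arbitrary: v rule: less_induct)
  case less
  show ?case
  proof (cases "basic v")
    case False
    then obtain v' where v': "v' \<in> feasible" "v' u \<le> v u" "tight v \<subset> tight v'"
      using improve less.prems by blast
    have "tight v' \<subseteq> F" by (auto simp: tight_def)
    then have "F - tight v' \<subset> F - tight v" using v'(3) by blast
    then have "card (F - tight v') < card (F - tight v)" by (rule psubset_card_mono[OF finite_Diff[OF finite_F]])
    then show ?thesis using less.hyps v' order_trans by blast
  qed auto
qed

lemma basic_value_cong:
  assumes "basic v" "basic v'" "tight v = tight v'"
  shows "v u = v' u"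
proof -
  define w where "w = (\<lambda>x. v x + (- 1) * v' x)"
  have "w \<in> NQ"
    unfolding w_def by (rule NQ_combine) (use assms in \<open>auto simp: basic_def feasible_def\<close>)
  moreover have "\<forall>(x, a) \<in> tight v. w x = 0"
  proof clarify
    fix x a assume "(x, a) \<in> tight v"
    moreover from this have "(x, a) \<in> tight v'" using assms(3) by simp
    ultimately show "w x = 0" by (simp add: tight_def w_def)
  qed
  ultimately have "w u = 0" using assms(1) unfolding basic_def by blast
  then show ?thesis by (simp add: w_def)
qed

lemma minimum_attained:
  assumes "feasible \<noteq> {}"
  obtains v where "v \<in> feasible" "\<And>w. w \<in> feasible \<Longrightarrow> v u \<le> w u"
proof -
  define vals where "vals = {v u | v. basic v}"
  have "vals \<subseteq> (\<lambda>A. (SOME v. basic v \<and> tight v = A) u) ` Pow F"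
  proof
    fix r assume "r \<in> vals"
    then obtain v where v: "basic v" "r = v u" by (auto simp: vals_def)
    define v' where "v' = (SOME v'. basic v' \<and> tight v' = tight v)"
    have "basic v' \<and> tight v' = tight v" unfolding v'_def by (rule someI[of _ v]) (use v in simp)
    then have "r = v' u" using basic_value_cong v by blast
    moreover have "tight v \<in> Pow F" by (auto simp: tight_def)
    ultimately show "r \<in> (\<lambda>A. (SOME v. basic v \<and> tight v = A) u) ` Pow F" unfolding v'_def by blast
  qed
  then have fin: "finite vals" using finite_F by (meson finite_Pow_iff finite_imageI finite_subset)
  have "vals \<noteq> {}" using assms dominated_by_basic by (auto simp: vals_def)
  then have "Min vals \<in> vals" using fin by simp
  then obtain v where v: "basic v" "v u = Min vals" by (auto simp: vals_def)
  show ?thesis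
  proof
    show "v \<in> feasible" using v by (simp add: basic_def)
    fix w assume "w \<in> feasible"
    then obtain v' where "basic v'" "v' u \<le> w u" using dominated_by_basic by blast
    moreover from this have "Min vals \<le> v' u" using fin by (auto simp: vals_def intro!: Min_le)
    ultimately show "v u \<le> w u" using v by simp
  qed
qed

end

text \<open>The recession cone of the inequalities is contained in the tail cone, so an element of the dual of the
  tail cone satisfies the hypothesis of the linear program.\<close>

lemma min_on_attained:
  assumes D: "polyhedron_in_NQ D" "D \<noteq> {}" and u: "u \<in> dual_lattice_points (tailcone D)"
  obtains v where "v \<in> D" "min_on D u = Fin (v u)" "\<And>w. w \<in> D \<Longrightarrow> v u \<le> w u"
proof -
  obtain F where F: "finite F" "D = {v \<in> NQ. \<forall>(x, a) \<in> F. a \<le> v x}"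
    using D by (auto simp: polyhedron_in_NQ_def)
  interpret linear_program F u
  proof
    fix w assume w: "w \<in> NQ" "\<And>x a. (x, a) \<in> F \<Longrightarrow> 0 \<le> w x"
    have "w \<in> tailcone D"
      using w NQ_combine[of _ w 1] unfolding tailcone_def F by (fastforce intro: add_increasing2)
    then show "0 \<le> w u" using u by (auto simp: dual_lattice_points_def)
  qed (rule F)
  have "D = feasible" by (simp add: F feasible_def)
  then obtain v where v: "v \<in> D" "\<And>w. w \<in> D \<Longrightarrow> v u \<le> w u" using minimum_attained D by metis
  then have "(LEAST r. r \<in> (\<lambda>v. v u) ` D) = v u" by (intro Least_equality) auto
  then show ?thesis using that v D by (auto simp: min_on_def)
qed

text \<open>The minimum of a sum is at least the sum of the minima. This is what makes both the sections and the pairs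
  in the weight semigroup closed under the graded product.\<close>

lemma floor_min_superadditive:
  assumes D: "D = {} \<or> polyhedron_in_NQ D \<and> tailcone D = \<sigma>"
    and u: "u \<in> dual_lattice_points \<sigma>" "u' \<in> dual_lattice_points \<sigma>"
    and uu': "u + u' \<in> dual_lattice_points \<sigma>"
  shows "floor_min D u + floor_min D u' \<le> floor_min D (u + u')"
proof (cases "D = {}")
  case True
  then show ?thesis by (simp add: floor_min_def min_on_def)
next
  case False
  then have P: "polyhedron_in_NQ D" "tailcone D = \<sigma>" using D by auto
  obtain v where v: "v \<in> D" "min_on D u = Fin (v u)" "\<And>w. w \<in> D \<Longrightarrow> v u \<le> w u"
    using min_on_attained[OF P(1) False] u(1) P(2) by metis
  obtain v' where v': "v' \<in> D" "min_on D u' = Fin (v' u')" "\<And>w. w \<in> D \<Longrightarrow> v' u' \<le> w u'"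
    using min_on_attained[OF P(1) False] u(2) P(2) by metis
  obtain v'' where v'': "v'' \<in> D" "min_on D (u + u') = Fin (v'' (u + u'))"
    using min_on_attained[OF P(1) False] uu' P(2) by metis
  have "v'' (u + u') = v'' u + v'' u'"
    using v''(1) P(1) by (auto simp: polyhedron_in_NQ_def NQ_def additive_def)
  then have "v u + v' u' \<le> v'' (u + u')" using v(3)[OF v''(1)] v'(3)[OF v''(1)] by simp
  then have "\<lfloor>v u\<rfloor> + \<lfloor>v' u'\<rfloor> \<le> \<lfloor>v'' (u + u')\<rfloor>" by linarith
  then show ?thesis using v(2) v'(2) v''(2) by (simp add: floor_min_def)
qed

lemma floor_min_at_0:
  assumes "D = {} \<or> polyhedron_in_NQ D"
  shows "0 \<le> floor_min D 0"
proof (cases "D = {}")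
  case False
  then have "D \<subseteq> NQ" using assms by (auto simp: polyhedron_in_NQ_def)
  then have "v 0 = 0" if "v \<in> D" for v using that additive.zero[of v] by (auto simp: NQ_def)
  then have "(\<lambda>v. v 0) ` D = {0}" using False by force
  then show ?thesis using False by (simp add: floor_min_def min_on_def zero_extended_def Least_equality)
qed (simp add: floor_min_def min_on_def)


section \<open>Ranks of subgroups of lattices\<close>

interpretation zm: module "zmul :: int \<Rightarrow> 'a::ab_group_add \<Rightarrow> 'a"
  by (rule module_zmul)

text \<open>Linear algebra over \<open>\<rat>\<close> takes place in spaces of rational-valued functions, into which lattices embed by
  coordinates.\<close>

interpretation ratfun: vector_space "\<lambda>(c::rat) (f::'x \<Rightarrow> rat) x. c * f x"
  by unfold_locales (auto simp: fun_eq_iff algebra_simps)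

lemma sum_fun_apply: "(\<Sum>i\<in>I. F i) x = (\<Sum>i\<in>I. F i x)" for F :: "'i \<Rightarrow> 'x \<Rightarrow> rat"
  by (induction I rule: infinite_finite_induct) auto

lemma zmul_ratfun: "zmul k (f :: 'x \<Rightarrow> rat) = (\<lambda>x. of_int k * f x)"
proof -
  have s: "(\<Sum>i<n. f) = (\<lambda>x. of_nat n * f x)" for n by (induction n) (auto simp: fun_eq_iff algebra_simps)
  show ?thesis by (cases "k \<ge> 0") (auto simp: zmul_def s fun_eq_iff simp del: sum_constant)
qed

lemma additive_zmul:
  assumes "additive f" shows "f (zmul k x) = zmul k (f x)"
proof -
  interpret additive f by fact
  show ?thesis by (simp add: zmul_def diff sum)
qed

lemma module_hom_zmul: "additive f \<Longrightarrow> module_hom zmul zmul f"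
  by unfold_locales (auto simp: additive_zmul additive_def)

definition unit_fun :: "'x \<Rightarrow> 'x \<Rightarrow> rat" where
  "unit_fun z = (\<lambda>x. if x = z then 1 else 0)"

lemma ratfun_span_finite_support:
  assumes "finite S" "\<And>z. z \<notin> S \<Longrightarrow> f z = 0"
  shows "f \<in> ratfun.span (unit_fun ` S)"
proof -
  have "f = (\<Sum>z\<in>S. (\<lambda>x. f z * unit_fun z x))"
    using assms by (auto simp: fun_eq_iff unit_fun_def sum_fun_apply if_distrib cong: if_cong)
  moreover have "(\<Sum>z\<in>S. (\<lambda>x. f z * unit_fun z x)) \<in> ratfun.span (unit_fun ` S)"
    by (intro ratfun.span_sum ratfun.span_scale ratfun.span_base) auto
  ultimately show ?thesis by simp
qed

lemma common_denominator:
  assumes "finite S"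
  shows "\<exists>k n. k \<noteq> 0 \<and> (\<forall>x\<in>S. of_int k * r x = (of_int (n x) :: rat))"
  using assms
  proof (induction S)
    case empty
    then show ?case by (auto intro: exI[of _ 1])
  next
    case (insert y S)
    then obtain k n where kn: "k \<noteq> 0" "\<forall>x\<in>S. of_int k * r x = (of_int (n x) :: rat)" by blast
    obtain a b where ab: "r y = of_int a / of_int b" "b > 0"
      using quotient_of_div quotient_of_denom_pos by (metis prod.exhaust)
    let ?n = "\<lambda>x. if x = y then k * a else b * n x"
    have "\<forall>x\<in>insert y S. of_int (k * b) * r x = (of_int (?n x) :: rat)"
    proof
      fix x assume "x \<in> insert y S"
      then show "of_int (k * b) * r x = (of_int (?n x) :: rat)" using kn ab by (auto simp: algebra_simps)
    qed
    moreover have "k * b \<noteq> 0" using kn ab by simp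
    ultimately show ?case by (intro exI[of _ "k * b"] exI[of _ ?n] conjI)
qed

text \<open>Multiplying a rational relation by a common denominator gives an integral one, so \<open>\<int>\<close>-independent elements have
  \<open>\<rat>\<close>-independent images, and the exchange lemma applies to these.\<close>

lemma card_independent_le:
  fixes \<theta> :: "'a::ab_group_add \<Rightarrow> 'x \<Rightarrow> rat"
  assumes \<theta>: "additive \<theta>" and inj: "inj_on \<theta> (zm.span W)"
    and T: "finite T" "\<theta> ` W \<subseteq> ratfun.span T"
    and C: "finite C" "C \<subseteq> zm.span W" "\<not> zm.dependent C"
  shows "card C \<le> card T"
proof -
  interpret \<theta>: module_hom zmul zmul \<theta> by (rule module_hom_zmul[OF \<theta>])
  have kernel: "x = 0" if "x \<in> zm.span W" "\<theta> x = 0" for x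
    using inj that zm.span_zero[of W] \<theta>.zero unfolding inj_on_def by metis
  have injC: "inj_on \<theta> C" using inj C(2) inj_on_subset by blast
  have "\<theta> ` zm.span W \<subseteq> ratfun.span T"
  proof (rule image_subsetI)
    fix x assume "x \<in> zm.span W"
    then show "\<theta> x \<in> ratfun.span T"
    proof (induction rule: zm.span_induct_alt)
      case base
      show ?case unfolding \<theta>.zero by (rule ratfun.span_zero)
    next
      case (step c x y)
      have eq: "\<theta> (zmul c x + y) = (\<lambda>z. of_int c * \<theta> x z) + \<theta> y"
        by (simp add: \<theta>.add \<theta>.scale zmul_ratfun)
      have "\<theta> x \<in> ratfun.span T" using step(1) T(2) by blast
      then show ?case unfolding eq using step(2) by (intro ratfun.span_add ratfun.span_scale)
    qed
  qed
  then have sub: "\<theta> ` C \<subseteq> ratfun.span T" using C(2) by blast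
  have "\<not> ratfun.dependent (\<theta> ` C)"
  proof
    assume "ratfun.dependent (\<theta> ` C)"
    then obtain r y where r: "y \<in> \<theta> ` C" "r y \<noteq> 0" "(\<Sum>v\<in>\<theta> ` C. (\<lambda>x. r v * v x)) = 0"
      unfolding ratfun.dependent_finite[OF finite_imageI[OF C(1)]] by blast
    obtain x0 where x0: "x0 \<in> C" "y = \<theta> x0" using r by blast
    have sum0: "(\<Sum>c\<in>C. r (\<theta> c) * \<theta> c x) = 0" for x
      using fun_cong[OF r(3), of x] injC by (simp add: sum.reindex sum_fun_apply)
    obtain k n where kn: "k \<noteq> 0" "\<forall>c\<in>C. of_int k * r (\<theta> c) = (of_int (n c) :: rat)"
      using common_denominator[OF C(1), of "\<lambda>c. r (\<theta> c)"] by blast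
    have "\<theta> (\<Sum>c\<in>C. zmul (n c) c) = 0"
    proof
      fix x
      have "\<theta> (\<Sum>c\<in>C. zmul (n c) c) x = (\<Sum>c\<in>C. of_int k * r (\<theta> c) * \<theta> c x)"
        by (simp add: \<theta>.sum \<theta>.scale zmul_ratfun sum_fun_apply kn)
      also have "\<dots> = of_int k * (\<Sum>c\<in>C. r (\<theta> c) * \<theta> c x)" by (simp add: sum_distrib_left mult.assoc)
      finally show "\<theta> (\<Sum>c\<in>C. zmul (n c) c) x = 0 x" using sum0 by simp
    qed
    moreover have "(\<Sum>c\<in>C. zmul (n c) c) \<in> zm.span W"
      using C(2) by (intro zm.span_sum zm.span_scale) auto
    ultimately have "(\<Sum>c\<in>C. zmul (n c) c) = 0" by (intro kernel)
    then have "n x0 = 0" using zm.independentD[OF C(3) C(1) subset_refl, of n x0] x0 by simp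
    then show False using kn(1) bspec[OF kn(2) x0(1)] r(2) x0 by simp
  qed
  then have "card (\<theta> ` C) \<le> card T" using ratfun.independent_span_bound[OF T(1) _ sub] by simp
  then show ?thesis using injC by (simp add: card_image)
qed

text \<open>A nontrivial kernel costs rank: lifts of independent elements of the image, together with an element \<open>d\<close>
  of the kernel, are independent in the source. Torsion is excluded by the embedding \<open>\<theta>\<close>.\<close>

lemma group_rank_image_less:
  fixes \<theta> :: "'a::ab_group_add \<Rightarrow> 'x \<Rightarrow> rat" and \<rho> :: "'a \<Rightarrow> 'g::ab_group_add"
  assumes \<theta>: "additive \<theta>" and inj: "inj_on \<theta> (zm.span W)"
    and T: "finite T" "\<theta> ` W \<subseteq> ratfun.span T"
    and \<rho>: "additive \<rho>" and d: "d \<in> zm.span W" "d \<noteq> 0" "\<rho> d = 0"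
  shows "group_rank (zm.span (\<rho> ` W)) < enat (card T)"
proof -
  interpret \<rho>: module_hom zmul zmul \<rho> by (rule module_hom_zmul[OF \<rho>])
  interpret \<theta>: module_hom zmul zmul \<theta> by (rule module_hom_zmul[OF \<theta>])
  have \<theta>d: "\<theta> d \<noteq> 0" using inj d zm.span_zero[of W] \<theta>.zero unfolding inj_on_def by metis
  have bound: "card C < card T"
    if C: "finite C" "C \<subseteq> zm.span (\<rho> ` W)" "\<not> zm.dependent C" for C
  proof -
    have "C \<subseteq> \<rho> ` zm.span W" using C(2) by (simp add: \<rho>.span_image)
    then have "\<exists>x. x \<in> zm.span W \<and> \<rho> x = c" if "c \<in> C" for c using that by blast
    then obtain s where s: "\<And>c. c \<in> C \<Longrightarrow> s c \<in> zm.span W" "\<And>c. c \<in> C \<Longrightarrow> \<rho> (s c) = c" by metis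
    have injs: "inj_on s C" using s(2) by (metis inj_onI)
    have dC: "d \<notin> s ` C"
    proof
      assume "d \<in> s ` C"
      then have "0 \<in> C" using s(2) d(3) by force
      then show False using C(3) zm.dependent_zero[of C] by simp
    qed
    have "\<not> zm.dependent (insert d (s ` C))"
    proof
      assume "zm.dependent (insert d (s ` C))"
      then obtain n y where n: "y \<in> insert d (s ` C)" "n y \<noteq> 0" "(\<Sum>v\<in>insert d (s ` C). zmul (n v) v) = 0"
        using zm.dependent_finite[of "insert d (s ` C)"] C(1) by auto
      have eq: "zmul (n d) d + (\<Sum>c\<in>C. zmul (n (s c)) (s c)) = 0"
        using n(3) C(1) dC injs by (simp add: sum.reindex)
      then have "\<rho> (zmul (n d) d + (\<Sum>c\<in>C. zmul (n (s c)) (s c))) = 0" by simp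
      then have "(\<Sum>c\<in>C. zmul (n (s c)) c) = 0"
        by (simp add: \<rho>.add \<rho>.scale \<rho>.sum s(2) d(3) cong: sum.cong)
      then have ns: "n (s c) = 0" if "c \<in> C" for c
        using zm.independentD[OF C(3) C(1) subset_refl, of "\<lambda>c. n (s c)"] that by blast
      then have "zmul (n d) d = 0" using eq by simp
      then have "zmul (n d) (\<theta> d) = 0" by (metis \<theta>.scale \<theta>.zero)
      then have "n d = 0" using \<theta>d by (auto simp: zmul_ratfun fun_eq_iff)
      then show False using ns n(1,2) by auto
    qed
    moreover have "insert d (s ` C) \<subseteq> zm.span W" using d s by auto
    ultimately have "card (insert d (s ` C)) \<le> card T"
      using card_independent_le[OF \<theta> inj T, of "insert d (s ` C)"] C(1) by simp
    then show ?thesis using dC C(1) injs by (simp add: card_image)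
  qed
  have pos: "0 < card T" using bound[of "{}"] zm.independent_empty by simp
  have "group_rank (zm.span (\<rho> ` W)) \<le> enat (card T - 1)"
    unfolding group_rank_def
  proof (rule Sup_least)
    fix k assume "k \<in> {enat (card C) |C. finite C \<and> C \<subseteq> zm.span (\<rho> ` W) \<and> zm.independent C}"
    then obtain C where "k = enat (card C)" "finite C" "C \<subseteq> zm.span (\<rho> ` W)" "\<not> zm.dependent C" by blast
    then show "k \<le> enat (card T - 1)" using bound[of C] by simp
  qed
  also have "\<dots> < enat (card T)" using pos by simp
  finally show ?thesis .
qed

text \<open>The coordinate \<open>None\<close> is kept free, as a place for the second component of \<open>M \<times> \<int>\<close>.\<close>

lemma lattice_embedding:
  assumes "fg_free TYPE('m::ab_group_add)"
  obtains \<iota> :: "'m::ab_group_add \<Rightarrow> 'm option \<Rightarrow> rat" and S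
  where "additive \<iota>" "inj \<iota>" "finite S" "\<And>u z. z \<notin> S \<Longrightarrow> \<iota> u z = 0" "\<And>u. \<iota> u None = 0"
proof -
  obtain B :: "'m set" where B: "finite B" "\<not> zm.dependent B" "zm.span B = UNIV"
    using assms by (auto simp: fg_free_def)
  define \<iota> :: "'m \<Rightarrow> 'm option \<Rightarrow> rat"
    where "\<iota> u z = (case z of None \<Rightarrow> 0 | Some b \<Rightarrow> of_int (zm.representation B u b))" for u z
  have "additive \<iota>"
    unfolding additive_def using zm.representation_add[OF B(2)] B(3)
    by (auto simp: \<iota>_def fun_eq_iff split: option.split)
  moreover have "inj \<iota>"
  proof (rule injI)
    fix u u' assume eq: "\<iota> u = \<iota> u'"
    have "zm.representation B u b = zm.representation B u' b" for b
      using fun_cong[OF eq, of "Some b"] by (simp add: \<iota>_def)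
    then have "zm.representation B u = zm.representation B u'" by blast
    then show "u = u'" using zm.sum_representation_eq[OF B(2) _ B(1) subset_refl] B(3) by (metis UNIV_I)
  qed
  moreover have "\<iota> u z = 0" if "z \<notin> Some ` B" for u z
  proof (cases z)
    case (Some b)
    then have "b \<notin> B" using that by auto
    then have "zm.representation B u b = 0" using zm.representation_ne_zero by blast
    then show ?thesis using Some by (simp add: \<iota>_def)
  qed (simp add: \<iota>_def)
  moreover have "\<iota> u None = 0" for u by (simp add: \<iota>_def)
  ultimately show ?thesis using that B(1) by blast
qed


section \<open>Homomorphisms of group algebras and their kernels\<close>

lemma sum_single_keys:
  "f = (\<Sum>u\<in>Poly_Mapping.keys f. Poly_Mapping.single u (Poly_Mapping.lookup f u))"
  by (rule poly_mapping_eqI) (simp add: lookup_sum lookup_single when_def in_keys_iff)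

text \<open>The homomorphism of group algebras induced by a map \<open>\<phi>\<close> of exponents and a map \<open>h\<close> of coefficients. The
  latter need only be a homomorphism on a subring containing the coefficients, since evaluation of rational functions
  is not defined everywhere.\<close>

definition push :: "('m \<Rightarrow> 'a) \<Rightarrow> ('f::zero \<Rightarrow> 'e::comm_monoid_add) \<Rightarrow> ('m \<Rightarrow>\<^sub>0 'f) \<Rightarrow> ('a \<Rightarrow>\<^sub>0 'e)" where
  "push \<phi> h f = (\<Sum>u\<in>Poly_Mapping.keys f. Poly_Mapping.single (\<phi> u) (h (Poly_Mapping.lookup f u)))"

lemma push_superset:
  assumes "h 0 = 0" "finite S" "Poly_Mapping.keys f \<subseteq> S"
  shows "push \<phi> h f = (\<Sum>u\<in>S. Poly_Mapping.single (\<phi> u) (h (Poly_Mapping.lookup f u)))"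
  unfolding push_def by (rule sum.mono_neutral_left) (use assms in \<open>auto simp: in_keys_iff\<close>)

lemma push_0 [simp]: "push \<phi> h 0 = 0"
  by (simp add: push_def)

lemma push_single:
  assumes "h 0 = 0" shows "push \<phi> h (Poly_Mapping.single u x) = Poly_Mapping.single (\<phi> u) (h x)"
  by (subst push_superset[of h "{u}"]) (use assms in auto)

definition coeffs_in :: "'f::zero set \<Rightarrow> ('m \<Rightarrow>\<^sub>0 'f) set" where
  "coeffs_in C = {f. \<forall>u. Poly_Mapping.lookup f u \<in> C}"

locale coefficient_hom =
  fixes C :: "'f::comm_ring_1 set" and h :: "'f \<Rightarrow> 'e::comm_ring_1"
  assumes C_0: "0 \<in> C"
    and C_add: "x \<in> C \<Longrightarrow> y \<in> C \<Longrightarrow> x + y \<in> C"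
    and C_mult: "x \<in> C \<Longrightarrow> y \<in> C \<Longrightarrow> x * y \<in> C"
    and h_0: "h 0 = 0" and h_1: "h 1 = 1"
    and h_add: "x \<in> C \<Longrightarrow> y \<in> C \<Longrightarrow> h (x + y) = h x + h y"
    and h_mult: "x \<in> C \<Longrightarrow> y \<in> C \<Longrightarrow> h (x * y) = h x * h y"
begin

lemma coeffs_in_add: "f \<in> coeffs_in C \<Longrightarrow> g \<in> coeffs_in C \<Longrightarrow> f + g \<in> coeffs_in C"
  by (auto simp: coeffs_in_def lookup_add C_add)

lemma coeffs_in_single: "x \<in> C \<Longrightarrow> Poly_Mapping.single u x \<in> coeffs_in C"
  by (auto simp: coeffs_in_def lookup_single when_def C_0)

lemma coeffs_in_0: "0 \<in> coeffs_in C"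
  by (auto simp: coeffs_in_def C_0)

lemma coeffs_in_sum: "(\<And>i. i \<in> I \<Longrightarrow> F i \<in> coeffs_in C) \<Longrightarrow> sum F I \<in> coeffs_in C"
  by (induction I rule: infinite_finite_induct) (auto simp: coeffs_in_0 coeffs_in_add)

lemma push_add:
  assumes "f \<in> coeffs_in C" "g \<in> coeffs_in C"
  shows "push \<phi> h (f + g) = push \<phi> h f + push \<phi> h g"
proof -
  let ?S = "Poly_Mapping.keys f \<union> Poly_Mapping.keys g"
  have S: "finite ?S" "Poly_Mapping.keys (f + g) \<subseteq> ?S" by (simp_all add: Poly_Mapping.keys_add)
  show ?thesis
    using assms by (simp add: push_superset[where h = h and \<phi> = \<phi>, OF h_0 S] push_superset[where h = h and \<phi> = \<phi>, OF h_0 S(1)] sum.distrib[symmetric]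
      lookup_add coeffs_in_def h_add single_add)
qed

lemma push_sum:
  "(\<And>i. i \<in> I \<Longrightarrow> F i \<in> coeffs_in C) \<Longrightarrow> push \<phi> h (sum F I) = (\<Sum>i\<in>I. push \<phi> h (F i))"
  by (induction I rule: infinite_finite_induct) (auto simp: push_add coeffs_in_sum)

lemma push_1: "\<phi> 0 = 0 \<Longrightarrow> push \<phi> h 1 = 1"
  using push_single[of h \<phi> 0 1] by (simp add: h_0 h_1)

lemma push_mult:
  fixes \<phi> :: "'m::comm_monoid_add \<Rightarrow> 'a::comm_monoid_add"
  assumes \<phi>: "\<And>u v. \<phi> (u + v) = \<phi> u + \<phi> v"
    and fg: "f \<in> coeffs_in C" "g \<in> coeffs_in C"
  shows "push \<phi> h (f * g) = push \<phi> h f * push \<phi> h g"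
proof -
  let ?f = "Poly_Mapping.lookup f" and ?g = "Poly_Mapping.lookup g"
  let ?F = "Poly_Mapping.keys f" and ?G = "Poly_Mapping.keys g"
  have C: "?f u \<in> C" "?g u \<in> C" for u using fg by (auto simp: coeffs_in_def)
  have "f * g = (\<Sum>u\<in>?F. Poly_Mapping.single u (?f u)) * (\<Sum>v\<in>?G. Poly_Mapping.single v (?g v))"
    by (simp flip: sum_single_keys)
  also have "\<dots> = (\<Sum>u\<in>?F. \<Sum>v\<in>?G. Poly_Mapping.single (u + v) (?f u * ?g v))"
    by (simp add: sum_product mult_single)
  finally have "push \<phi> h (f * g) = (\<Sum>u\<in>?F. \<Sum>v\<in>?G. Poly_Mapping.single (\<phi> u + \<phi> v) (h (?f u) * h (?g v)))"
    using C by (simp add: push_sum coeffs_in_sum coeffs_in_single C_mult push_single h_0 \<phi> h_mult)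
  also have "\<dots> = push \<phi> h f * push \<phi> h g"
    by (simp add: push_def sum_product mult_single)
  finally show ?thesis .
qed

end

lemma (in coefficient_hom) push_push:
  fixes h' :: "'d::zero \<Rightarrow> 'f"
  assumes "h' 0 = 0" "\<And>u. h' (Poly_Mapping.lookup f u) \<in> C"
  shows "push \<tau> h (push \<phi> h' f) = push (\<lambda>u. \<tau> (\<phi> u)) (\<lambda>x. h (h' x)) f"
  unfolding push_def[of \<phi>] push_def[of "\<lambda>u. \<tau> (\<phi> u)"]
  by (subst push_sum) (auto intro: coeffs_in_single assms(2) simp: push_single h_0)

lemma cring_subring_of_type:
  assumes "0 \<in> A" "1 \<in> A" "\<And>x y. x \<in> A \<Longrightarrow> y \<in> A \<Longrightarrow> x + y \<in> A"
    "\<And>x. x \<in> A \<Longrightarrow> - x \<in> A" "\<And>x y. x \<in> A \<Longrightarrow> y \<in> A \<Longrightarrow> x * y \<in> A"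
  shows "cring (subring_of_type A)"
proof (rule cringI)
  show "abelian_group (subring_of_type A)"
  proof (rule abelian_groupI)
    fix x assume "x \<in> carrier (subring_of_type A)"
    then show "\<exists>y\<in>carrier (subring_of_type A). y \<oplus>\<^bsub>subring_of_type A\<^esub> x = \<zero>\<^bsub>subring_of_type A\<^esub>"
      using assms(4)[of x] by (auto simp: subring_of_type_def intro: bexI[of _ "- x"])
  qed (use assms in \<open>auto simp: subring_of_type_def algebra_simps\<close>)
  show "comm_monoid (subring_of_type A)"
    by (rule comm_monoidI) (use assms in \<open>auto simp: subring_of_type_def algebra_simps\<close>)
qed (auto simp: subring_of_type_def algebra_simps)

lemma primeideal_kernel:
  fixes \<Phi> :: "'a::comm_ring_1 \<Rightarrow> 'b::idom"
  assumes A: "0 \<in> A" "1 \<in> A" "\<And>x y. x \<in> A \<Longrightarrow> y \<in> A \<Longrightarrow> x + y \<in> A"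
    "\<And>x. x \<in> A \<Longrightarrow> - x \<in> A" "\<And>x y. x \<in> A \<Longrightarrow> y \<in> A \<Longrightarrow> x * y \<in> A"
    and \<Phi>: "\<Phi> 1 = 1" "\<And>x y. x \<in> A \<Longrightarrow> y \<in> A \<Longrightarrow> \<Phi> (x + y) = \<Phi> x + \<Phi> y"
    "\<And>x y. x \<in> A \<Longrightarrow> y \<in> A \<Longrightarrow> \<Phi> (x * y) = \<Phi> x * \<Phi> y"
  shows "primeideal {x \<in> A. \<Phi> x = 0} (subring_of_type A)"
proof -
  interpret R: cring "subring_of_type A" by (rule cring_subring_of_type[OF A])
  have \<Phi>0: "\<Phi> 0 = 0" using \<Phi>(2)[OF A(1) A(1)] by (metis add_0_right add_cancel_right_right)
  have \<Phi>neg: "\<Phi> (- x) = - \<Phi> x" if "x \<in> A" for x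
    using \<Phi>(2)[of x "- x"] that A(4) \<Phi>0 by (simp add: minus_unique)
  show ?thesis
  proof (rule primeidealI)
    show "ideal {x \<in> A. \<Phi> x = 0} (subring_of_type A)"
    proof (rule idealI)
      show "ring (subring_of_type A)" by (rule R.ring_axioms)
      show "subgroup {x \<in> A. \<Phi> x = 0} (add_monoid (subring_of_type A))"
      proof (rule group.subgroupI)
        show "group (add_monoid (subring_of_type A))" by (rule R.a_group)
        fix x assume x: "x \<in> {x \<in> A. \<Phi> x = 0}"
        have "inv\<^bsub>add_monoid (subring_of_type A)\<^esub> x = - x"
          using x A(4) by (intro group.inv_equality[OF R.a_group]) (auto simp: subring_of_type_def)
        then show "inv\<^bsub>add_monoid (subring_of_type A)\<^esub> x \<in> {x \<in> A. \<Phi> x = 0}"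
          using x A(4) \<Phi>neg by simp
      qed (use A \<Phi> \<Phi>0 in \<open>auto simp: subring_of_type_def\<close>)
    qed (use A \<Phi> in \<open>auto simp: subring_of_type_def\<close>)
    show "cring (subring_of_type A)" by (rule R.cring_axioms)
    have "1 \<in> carrier (subring_of_type A)" "1 \<notin> {x \<in> A. \<Phi> x = 0}"
      using A(2) \<Phi>(1) by (auto simp: subring_of_type_def)
    then show "carrier (subring_of_type A) \<noteq> {x \<in> A. \<Phi> x = 0}" by metis
  qed (use \<Phi>(3) in \<open>auto simp: subring_of_type_def\<close>)
qed

lemma krull_dim_ge:
  assumes "\<And>i. i \<le> n \<Longrightarrow> primeideal (P i) R" "\<And>i. i < n \<Longrightarrow> P i \<subset> P (Suc i)"
  shows "enat n \<le> krull_dim R"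
  unfolding krull_dim_def by (rule Sup_upper) (use assms in blast)


section \<open>Sections and weights of a polyhedral divisor\<close>

lemma extended_le_sum:
  fixes d :: "'i \<Rightarrow> int extended"
  assumes "\<And>i. i \<in> I \<Longrightarrow> Fin (n i) \<le> d i"
  shows "Fin (\<Sum>i\<in>I. n i) \<le> (\<Sum>i\<in>I. d i)"
  using assms
proof (induction I rule: infinite_finite_induct)
  case (insert x I)
  then have "Fin (n x) + Fin (\<Sum>i\<in>I. n i) \<le> d x + (\<Sum>i\<in>I. d i)" by (intro add_mono) auto
  then show ?case using insert.hyps by simp
qed (auto simp: zero_extended_def)

lemma extended_sum_mono:
  fixes d e :: "'i \<Rightarrow> int extended"
  assumes "\<And>i. i \<in> I \<Longrightarrow> d i \<le> e i"
  shows "sum d I \<le> sum e I"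
  using assms by (induction I rule: infinite_finite_induct) (auto intro: add_mono)

text \<open>A finite bound below a sum that may contain infinite terms can be split into finite bounds below the terms:
  an infinite term absorbs whatever the others leave over, and otherwise any term absorbs the slack.\<close>

lemma extended_le_sumE:
  fixes d :: "'i \<Rightarrow> int extended"
  assumes "finite I" "I \<noteq> {}" "\<And>i. i \<in> I \<Longrightarrow> d i \<noteq> Minf" "Fin v \<le> (\<Sum>i\<in>I. d i)"
  shows "\<exists>n. (\<forall>i\<in>I. Fin (n i) \<le> d i) \<and> (\<Sum>i\<in>I. n i) = v"
  using assms
proof (induction I arbitrary: v rule: finite_ne_induct)
  case (singleton x)
  then show ?case by (intro exI[of _ "\<lambda>_. v"]) auto
next
  case (insert x I)
  have below: "\<exists>k. Fin k \<le> d i" if "i \<in> I" for i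
    using insert.prems(1)[of i] that by (cases "d i") auto
  have "\<exists>n k. (\<forall>i\<in>I. Fin (n i) \<le> d i) \<and> Fin k \<le> d x \<and> k + (\<Sum>i\<in>I. n i) = v"
  proof (cases "d x")
    case (Fin e)
    have "Fin (v - e) \<le> (\<Sum>i\<in>I. d i)"
      using insert.prems(2) insert.hyps Fin by (cases "\<Sum>i\<in>I. d i") auto
    then obtain n where "\<forall>i\<in>I. Fin (n i) \<le> d i" "(\<Sum>i\<in>I. n i) = v - e"
      using insert.IH insert.prems(1) by blast
    then show ?thesis using Fin by (intro exI[of _ n] exI[of _ e]) auto
  next
    case Pinf
    obtain n where "\<forall>i\<in>I. Fin (n i) \<le> d i" using below by metis
    then show ?thesis using Pinf by (intro exI[of _ n] exI[of _ "v - (\<Sum>i\<in>I. n i)"]) auto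
  next
    case Minf
    then show ?thesis using insert.prems(1) by simp
  qed
  then obtain n k where nk: "\<forall>i\<in>I. Fin (n i) \<le> d i" "Fin k \<le> d x" "k + (\<Sum>i\<in>I. n i) = v" by blast
  have eq: "(\<Sum>i\<in>I. if i = x then k else n i) = (\<Sum>i\<in>I. n i)"
    using insert.hyps by (intro sum.cong) auto
  show ?case
    by (rule exI[of _ "\<lambda>i. if i = x then k else n i"]) (use nk insert.hyps eq in auto)
qed

lemma extended_nonneg_add_iff: "0 \<le> Fin a + (d :: int extended) \<longleftrightarrow> Fin (- a) \<le> d"
  by (cases d) (auto simp: zero_extended_def)

lemma extended_uminus_le_iff: "- d \<le> Fin a \<longleftrightarrow> Fin (- a) \<le> (d :: int extended)"
  by (cases d) auto

lemma floor_min_not_Minf: "floor_min D u \<noteq> Minf"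
  by (auto simp: floor_min_def min_on_def)

lemma dual_lattice_points_0: "\<sigma> \<subseteq> NQ \<Longrightarrow> 0 \<in> dual_lattice_points \<sigma>"
  using additive.zero by (fastforce simp: dual_lattice_points_def NQ_def)

lemma dual_lattice_points_add:
  "\<sigma> \<subseteq> NQ \<Longrightarrow> u \<in> dual_lattice_points \<sigma> \<Longrightarrow> u' \<in> dual_lattice_points \<sigma> \<Longrightarrow>
    u + u' \<in> dual_lattice_points \<sigma>"
  using additive.add by (fastforce simp: dual_lattice_points_def NQ_def)

lemma add_monoid_on_image_iso:
  assumes \<rho>: "additive \<rho>" and W: "\<And>x y. x \<in> W \<Longrightarrow> y \<in> W \<Longrightarrow> x + y \<in> W" and inj: "inj_on \<rho> W"
  shows "add_monoid_on (\<rho> ` W) \<cong> add_monoid_on W"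
proof -
  have "inv_into W \<rho> (\<rho> x + \<rho> y) = x + y" if "x \<in> W" "y \<in> W" for x y
    using that W inv_into_f_f[OF inj] additive.add[OF \<rho>] by metis
  then have "inv_into W \<rho> \<in> hom (add_monoid_on (\<rho> ` W)) (add_monoid_on W)"
    using inj by (auto simp: hom_def add_monoid_on_def)
  moreover have "bij_betw (inv_into W \<rho>) (\<rho> ` W) W"
    by (rule bij_betw_inv_into) (use inj in \<open>simp add: bij_betw_def\<close>)
  ultimately show ?thesis by (auto simp: is_iso_def iso_def add_monoid_on_def)
qed

lemma span_of_additive_submonoid:
  assumes W: "0 \<in> W" "\<And>x y. x \<in> W \<Longrightarrow> y \<in> W \<Longrightarrow> x + y \<in> W" and d: "d \<in> zm.span W"
  obtains x y where "x \<in> W" "y \<in> W" "d = x - y"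
proof -
  let ?D = "{x - y | x y. x \<in> W \<and> y \<in> W}"
  have add: "a + b \<in> ?D" if ab: "a \<in> ?D" "b \<in> ?D" for a b
  proof -
    obtain x y x' y' where "x \<in> W" "y \<in> W" "x' \<in> W" "y' \<in> W" "a = x - y" "b = x' - y'"
      using ab by blast
    then have "a + b = (x + x') - (y + y')" "x + x' \<in> W" "y + y' \<in> W" using W(2) by auto
    then show ?thesis by blast
  qed
  have zero: "0 \<in> ?D" using W(1) by force
  have neg: "- a \<in> ?D" if "a \<in> ?D" for a using that by force
  have mult: "(\<Sum>i<n. a) \<in> ?D" if "a \<in> ?D" for a and n :: nat
  proof (induction n)
    case (Suc n)
    show ?case using add[OF Suc that] by simp
  qed (use zero in simp)
  have "zm.subspace ?D"
  proof (rule zm.subspaceI)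
    fix c x assume "x \<in> ?D"
    then have "(\<Sum>i<nat c. x) + - (\<Sum>i<nat (- c). x) \<in> ?D" by (intro add neg mult)
    then show "zmul c x \<in> ?D" unfolding zmul_def by (simp only: diff_conv_add_uminus)
  qed (use zero add in blast)+
  moreover have "W \<subseteq> ?D" using W(1) by force
  ultimately have "zm.span W \<subseteq> ?D" by (intro zm.span_minimal)
  then show ?thesis using d that by blast
qed

locale divisor_on_line =
  fixes m :: nat
    and \<sigma> :: "('m::ab_group_add \<Rightarrow> rat) set"
    and \<Delta> :: "nat \<Rightarrow> ('m \<Rightarrow> rat) set"
    and p q :: "nat \<Rightarrow> 'k::alg_closed_field"
    and Q :: "nat \<Rightarrow> (nat \<Rightarrow> 'k) set"
  assumes cone: "\<sigma> \<subseteq> NQ"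
    and coefficients: "i \<le> m \<Longrightarrow> \<Delta> i = {} \<or> (polyhedron_in_NQ (\<Delta> i) \<and> tailcone (\<Delta> i) = \<sigma>)"
    and line: "spans_line m p q"
    and Q_on_line: "i \<le> m \<Longrightarrow> Q i \<in> proj_line p q"
    and Q_distinct: "inj_on Q {..m}"
begin

abbreviation "ord \<equiv> line_ord p q"
abbreviation "sections u \<equiv> global_sections p q (poly_divisor m \<Delta> Q u)"
abbreviation "A \<equiv> RX m \<sigma> \<Delta> p q Q"
abbreviation "boundary \<equiv> Q ` {..m}"

lemma boundary_on_line: "boundary \<subseteq> proj_line p q"
  using Q_on_line by auto

lemma poly_divisor_boundary: "i \<le> m \<Longrightarrow> poly_divisor m \<Delta> Q u (Q i) = floor_min (\<Delta> i) u"
proof -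
  assume "i \<le> m"
  then have "{i'. i' \<le> m \<and> Q i' = Q i} = {i}" using Q_distinct by (auto simp: inj_on_def)
  then show ?thesis by (simp add: poly_divisor_def)
qed

lemma poly_divisor_interior: "P \<notin> boundary \<Longrightarrow> poly_divisor m \<Delta> Q u P = 0"
proof -
  assume "P \<notin> boundary"
  then have "{i. i \<le> m \<and> Q i = P} = {}" by auto
  then show ?thesis by (simp only: poly_divisor_def sum.empty)
qed

lemma sections_iff:
  "f \<in> sections u \<longleftrightarrow> f = 0 \<or> ((\<forall>i\<le>m. Fin (- ord (Q i) f) \<le> floor_min (\<Delta> i) u) \<and>
     (\<forall>P\<in>proj_line p q - boundary. 0 \<le> ord P f))"
proof -
  let ?ok = "\<lambda>P. 0 \<le> Fin (ord P f) + poly_divisor m \<Delta> Q u P"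
  have interior: "?ok P \<longleftrightarrow> 0 \<le> ord P f" if "P \<notin> boundary" for P
    using that by (simp add: poly_divisor_interior zero_extended_def)
  have boundary: "?ok (Q i) \<longleftrightarrow> Fin (- ord (Q i) f) \<le> floor_min (\<Delta> i) u" if "i \<le> m" for i
    using that by (simp add: poly_divisor_boundary extended_nonneg_add_iff)
  have "(\<forall>P\<in>proj_line p q. ?ok P) \<longleftrightarrow> (\<forall>i\<le>m. ?ok (Q i)) \<and> (\<forall>P\<in>proj_line p q - boundary. ?ok P)"
    using boundary_on_line by auto
  also have "\<dots> \<longleftrightarrow> (\<forall>i\<le>m. Fin (- ord (Q i) f) \<le> floor_min (\<Delta> i) u) \<and>
     (\<forall>P\<in>proj_line p q - boundary. 0 \<le> ord P f)"
    using interior boundary by auto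
  finally show ?thesis by (simp add: global_sections_def)
qed

lemma sections_ordD:
  assumes "f \<in> sections u" "f \<noteq> 0"
  shows "i \<le> m \<Longrightarrow> Fin (- ord (Q i) f) \<le> floor_min (\<Delta> i) u"
    and "P \<in> proj_line p q - boundary \<Longrightarrow> 0 \<le> ord P f"
  using assms by (auto simp: sections_iff)

lemma sections_0: "0 \<in> sections u"
  by (simp add: sections_iff)

lemma sections_add:
  assumes "f \<in> sections u" "g \<in> sections u"
  shows "f + g \<in> sections u"
proof (cases "f = 0 \<or> g = 0 \<or> f + g = 0")
  case True
  then show ?thesis using assms sections_0 by auto
next
  case False
  have ge: "min (ord P f) (ord P g) \<le> ord P (f + g)" for P
    using discrete_valuation.val_add[OF discrete_valuation_line_ord] False by blast
  note f = sections_ordD[OF assms(1)] and g = sections_ordD[OF assms(2)]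
  have "Fin (- ord (Q i) (f + g)) \<le> floor_min (\<Delta> i) u" if "i \<le> m" for i
  proof -
    have "Fin (- min (ord (Q i) f) (ord (Q i) g)) \<le> floor_min (\<Delta> i) u"
      using f(1)[OF _ that] g(1)[OF _ that] False by (auto simp: min_def)
    moreover have "Fin (- ord (Q i) (f + g)) \<le> Fin (- min (ord (Q i) f) (ord (Q i) g))"
      using ge[of "Q i"] by simp
    ultimately show ?thesis by (rule order_trans[rotated])
  qed
  moreover have "0 \<le> ord P (f + g)" if "P \<in> proj_line p q - boundary" for P
    using f(2)[OF _ that] g(2)[OF _ that] ge[of P] False by auto
  ultimately show ?thesis by (simp add: sections_iff)
qed

lemma sections_mult:
  assumes u: "u \<in> dual_lattice_points \<sigma>" "u' \<in> dual_lattice_points \<sigma>"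
    and fg: "f \<in> sections u" "g \<in> sections u'"
  shows "f * g \<in> sections (u + u')"
proof (cases "f = 0 \<or> g = 0")
  case True
  then show ?thesis using sections_0 by auto
next
  case False
  have ord: "ord P (f * g) = ord P f + ord P g" for P
    using discrete_valuation.val_mult[OF discrete_valuation_line_ord] False by blast
  note f = sections_ordD[OF fg(1)] and g = sections_ordD[OF fg(2)]
  have "Fin (- ord (Q i) (f * g)) \<le> floor_min (\<Delta> i) (u + u')" if i: "i \<le> m" for i
  proof -
    have "Fin (- ord (Q i) f) + Fin (- ord (Q i) g) \<le> floor_min (\<Delta> i) u + floor_min (\<Delta> i) u'"
      using False f(1)[OF _ i] g(1)[OF _ i] by (intro add_mono) auto
    also have "\<dots> \<le> floor_min (\<Delta> i) (u + u')"
      by (rule floor_min_superadditive[OF coefficients[OF i] u dual_lattice_points_add[OF cone u]])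
    finally show ?thesis by (simp add: ord)
  qed
  moreover have "0 \<le> ord P (f * g)" if "P \<in> proj_line p q - boundary" for P
    using f(2)[OF _ that] g(2)[OF _ that] False by (auto simp: ord)
  ultimately show ?thesis by (simp add: sections_iff)
qed

lemma const_in_sections: "const_fract k \<in> sections 0"
proof (cases "k = 0")
  case False
  have "0 \<le> floor_min (\<Delta> i) 0" if "i \<le> m" for i
    using floor_min_at_0 coefficients[OF that] by blast
  then show ?thesis using False by (simp add: sections_iff line_ord_const zero_extended_def)
qed (simp add: sections_iff const_fract_0_iff)

lemma A_iff:
  "f \<in> A \<longleftrightarrow> (\<forall>u. Poly_Mapping.lookup f u = 0 \<or>
     u \<in> dual_lattice_points \<sigma> \<and> Poly_Mapping.lookup f u \<in> sections u)"
  by (auto simp: RX_def in_keys_iff)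

lemma A_single: "u \<in> dual_lattice_points \<sigma> \<Longrightarrow> s \<in> sections u \<Longrightarrow> Poly_Mapping.single u s \<in> A"
  by (auto simp: A_iff lookup_single when_def)

lemma A_const: "Poly_Mapping.single 0 (const_fract k) \<in> A"
  by (intro A_single const_in_sections dual_lattice_points_0 cone)

lemma A_0: "0 \<in> A"
  by (simp add: A_iff)

lemma A_1: "1 \<in> A"
proof -
  have "const_fract (1 :: 'k) = 1" by (simp add: const_fract_def One_fract_def one_pCons)
  then show ?thesis using A_const[of 1] by simp
qed

lemma A_add: "f \<in> A \<Longrightarrow> g \<in> A \<Longrightarrow> f + g \<in> A"
  unfolding A_iff lookup_add by (metis add_0 add_0_right sections_add)

lemma A_sum: "(\<And>i. i \<in> I \<Longrightarrow> F i \<in> A) \<Longrightarrow> sum F I \<in> A"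
  by (induction I rule: infinite_finite_induct) (auto simp: A_0 A_add)

lemma A_mult:
  assumes "f \<in> A" "g \<in> A" shows "f * g \<in> A"
proof -
  let ?f = "Poly_Mapping.lookup f" and ?g = "Poly_Mapping.lookup g"
  let ?F = "Poly_Mapping.keys f" and ?G = "Poly_Mapping.keys g"
  have "f * g = (\<Sum>u\<in>?F. Poly_Mapping.single u (?f u)) * (\<Sum>v\<in>?G. Poly_Mapping.single v (?g v))"
    by (simp flip: sum_single_keys)
  also have "\<dots> = (\<Sum>u\<in>?F. \<Sum>v\<in>?G. Poly_Mapping.single (u + v) (?f u * ?g v))"
    by (simp add: sum_product mult_single)
  also have "\<dots> \<in> A"
    using assms by (intro A_sum A_single sections_mult dual_lattice_points_add cone) (auto simp: RX_def)
  finally show ?thesis .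
qed

lemma A_uminus:
  assumes "f \<in> A" shows "- f \<in> A"
proof -
  have c: "const_fract (-1 :: 'k) = -1"
    by (simp add: const_fract_def One_fract_def one_pCons)
  have "Poly_Mapping.single 0 (const_fract (- 1)) * f \<in> A" by (intro A_mult A_const assms)
  moreover have "Poly_Mapping.single 0 (const_fract (- 1 :: 'k)) = - 1"
    unfolding c by (simp add: single_uminus)
  ultimately show ?thesis by (metis mult_minus1)
qed

lemma weight_semigroup_iff:
  "(u, l) \<in> weight_semigroup m \<sigma> \<Delta> j \<longleftrightarrow> u \<in> dual_lattice_points \<sigma> \<and>
     Fin (- l) \<le> floor_min (\<Delta> j) u \<and> Fin l \<le> (\<Sum>i\<in>{..m} - {j}. floor_min (\<Delta> i) u)"
  by (simp add: weight_semigroup_def extended_uminus_le_iff)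

text \<open>The order at \<open>Q\<^sub>j\<close> is bounded below by definition, and above because the orders of a function at all points of
  the line add up to zero.\<close>

lemma section_weight:
  assumes u: "u \<in> dual_lattice_points \<sigma>" and f: "f \<in> sections u" "f \<noteq> 0" and j: "j \<le> m"
  shows "(u, ord (Q j) f) \<in> weight_semigroup m \<sigma> \<Delta> j"
proof -
  have "(\<Sum>P\<in>boundary. ord P f) \<le> 0"
    using sum_line_ord_le_0[OF line _ boundary_on_line f(2)] sections_ordD(2)[OF f] by blast
  then have "(\<Sum>i\<le>m. ord (Q i) f) \<le> 0" using Q_distinct by (simp add: sum.reindex)
  then have "ord (Q j) f \<le> (\<Sum>i\<in>{..m} - {j}. - ord (Q i) f)"
    using j by (simp add: sum.remove[of "{..m}" j] sum_negf)
  then have "Fin (ord (Q j) f) \<le> Fin (\<Sum>i\<in>{..m} - {j}. - ord (Q i) f)" by simp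
  also have "\<dots> \<le> (\<Sum>i\<in>{..m} - {j}. floor_min (\<Delta> i) u)"
    by (rule extended_le_sum) (use sections_ordD(1)[OF f] in auto)
  finally show ?thesis using u sections_ordD(1)[OF f j] by (simp add: weight_semigroup_iff)
qed

text \<open>Conversely, zeros and poles at the other points \<open>Q\<^sub>i\<close> can be chosen so that the total degree is zero. There
  is at least one other point since \<open>m \<ge> 1\<close>. The section has no zeros off the \<open>Q\<^sub>i\<close>, so that its value at a
  general point is a unit.\<close>

lemma weight_section:
  assumes m: "m \<ge> 1" and j: "j \<le> m" and ul: "(u, l) \<in> weight_semigroup m \<sigma> \<Delta> j"
  obtains f where "f \<noteq> 0" "f \<in> sections u" "ord (Q j) f = l"
    "\<And>P. P \<in> proj_line p q - boundary \<Longrightarrow> ord P f = 0"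
proof -
  let ?I = "{..m} - {j}"
  \<comment> \<open>An index different from \<open>j\<close>.\<close>
  have "(if j = 0 then 1 else 0) \<in> ?I" using m by auto
  then have "?I \<noteq> {}" by blast
  then obtain n where n: "\<forall>i\<in>?I. Fin (n i) \<le> floor_min (\<Delta> i) u" "(\<Sum>i\<in>?I. n i) = l"
    using extended_le_sumE[of ?I "\<lambda>i. floor_min (\<Delta> i) u" l] ul
    by (auto simp: weight_semigroup_iff floor_min_not_Minf)
  define N where "N i = (if i = j then l else - n i)" for i
  define D where "D P = N (inv_into {..m} Q P)" for P
  have D: "D (Q i) = N i" if "i \<le> m" for i using Q_distinct that by (simp add: D_def)
  have "sum D boundary = (\<Sum>i\<le>m. N i)" using Q_distinct by (simp add: sum.reindex D)
  also have "\<dots> = N j + (\<Sum>i\<in>?I. N i)" using j by (simp add: sum.remove[of "{..m}" j])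
  also have "(\<Sum>i\<in>?I. N i) = (\<Sum>i\<in>?I. - n i)" by (rule sum.cong) (auto simp: N_def)
  finally have "sum D boundary = 0" using n(2) by (simp add: N_def sum_negf)
  then obtain f where f: "f \<noteq> 0" "\<And>P. P \<in> boundary \<Longrightarrow> ord P f = D P"
    "\<And>P. P \<in> proj_line p q - boundary \<Longrightarrow> ord P f = 0"
    using exists_principal_divisor[OF line _ boundary_on_line] by (metis finite_atMost finite_imageI)
  have at: "ord (Q i) f = N i" if "i \<le> m" for i using f(2)[of "Q i"] that D by simp
  have "f \<in> sections u"
    using n(1) ul f(3) by (auto simp: sections_iff at N_def weight_semigroup_iff)
  then show ?thesis using that f(1,3) at[OF j] by (simp add: N_def)
qed

lemma weight_semigroup_add:
  assumes "x \<in> weight_semigroup m \<sigma> \<Delta> j" "y \<in> weight_semigroup m \<sigma> \<Delta> j" and j: "j \<le> m"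
  shows "x + y \<in> weight_semigroup m \<sigma> \<Delta> j"
proof -
  obtain u l u' l' where x: "x = (u, l)" and y: "y = (u', l')" by fastforce
  have u: "u \<in> dual_lattice_points \<sigma>" "u' \<in> dual_lattice_points \<sigma>"
    using assms by (auto simp: x y weight_semigroup_iff)
  have super: "floor_min (\<Delta> i) u + floor_min (\<Delta> i) u' \<le> floor_min (\<Delta> i) (u + u')" if "i \<le> m" for i
    by (rule floor_min_superadditive[OF coefficients[OF that] u dual_lattice_points_add[OF cone u]])
  have "Fin (- l) + Fin (- l') \<le> floor_min (\<Delta> j) u + floor_min (\<Delta> j) u'"
    using assms by (intro add_mono) (auto simp: x y weight_semigroup_iff)
  then have lower: "Fin (- l) + Fin (- l') \<le> floor_min (\<Delta> j) (u + u')"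
    using super[OF j] by (rule order_trans)
  have "Fin l + Fin l' \<le> (\<Sum>i\<in>{..m} - {j}. floor_min (\<Delta> i) u) + (\<Sum>i\<in>{..m} - {j}. floor_min (\<Delta> i) u')"
    using assms by (intro add_mono) (auto simp: x y weight_semigroup_iff)
  also have "\<dots> = (\<Sum>i\<in>{..m} - {j}. floor_min (\<Delta> i) u + floor_min (\<Delta> i) u')"
    by (rule sum.distrib[symmetric])
  also have "\<dots> \<le> (\<Sum>i\<in>{..m} - {j}. floor_min (\<Delta> i) (u + u'))"
    by (rule extended_sum_mono) (use super in auto)
  finally show ?thesis using lower u dual_lattice_points_add[OF cone u]
    by (simp add: x y weight_semigroup_iff)
qed

lemma weight_semigroup_0: "j \<le> m \<Longrightarrow> 0 \<in> weight_semigroup m \<sigma> \<Delta> j"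
proof -
  assume j: "j \<le> m"
  have nonneg: "Fin 0 \<le> floor_min (\<Delta> i) 0" if "i \<le> m" for i
    using floor_min_at_0 coefficients[OF that] by (auto simp: zero_extended_def)
  have "Fin (\<Sum>i\<in>{..m} - {j}. 0) \<le> (\<Sum>i\<in>{..m} - {j}. floor_min (\<Delta> i) 0)"
    by (rule extended_le_sum) (use nonneg in auto)
  then show ?thesis using nonneg[OF j] dual_lattice_points_0[OF cone]
    by (simp add: zero_prod_def weight_semigroup_iff)
qed

theorem value_semigroup_eq:
  fixes \<psi> :: "'m \<Rightarrow> 'g::linordered_ab_group_add"
  assumes m: "m \<ge> 1" and j: "j \<le> m"
  shows "value_semigroup A (val p q \<psi> (Q j) \<gamma>) =
    (\<lambda>(u, l). \<psi> u + zmul l \<gamma>) ` weight_semigroup m \<sigma> \<Delta> j"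
proof (intro Set.set_eqI iffI)
  fix g assume "g \<in> value_semigroup A (val p q \<psi> (Q j) \<gamma>)"
  then obtain f where f: "f \<in> A" "f \<noteq> 0" "g = val p q \<psi> (Q j) \<gamma> f"
    by (auto simp: value_semigroup_def)
  have "g \<in> (\<lambda>u. \<psi> u + zmul (ord (Q j) (Poly_Mapping.lookup f u)) \<gamma>) ` Poly_Mapping.keys f"
    unfolding f(3) val_def by (rule Min_in) (use f(2) in auto)
  then obtain u where u: "u \<in> Poly_Mapping.keys f" "g = \<psi> u + zmul (ord (Q j) (Poly_Mapping.lookup f u)) \<gamma>"
    by blast
  have "(u, ord (Q j) (Poly_Mapping.lookup f u)) \<in> weight_semigroup m \<sigma> \<Delta> j"
    using f(1) u(1) j by (intro section_weight) (auto simp: RX_def in_keys_iff)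
  then show "g \<in> (\<lambda>(u, l). \<psi> u + zmul l \<gamma>) ` weight_semigroup m \<sigma> \<Delta> j" using u(2) by force
next
  fix g assume "g \<in> (\<lambda>(u, l). \<psi> u + zmul l \<gamma>) ` weight_semigroup m \<sigma> \<Delta> j"
  then obtain u l where ul: "(u, l) \<in> weight_semigroup m \<sigma> \<Delta> j" "g = \<psi> u + zmul l \<gamma>" by auto
  obtain f where f: "f \<noteq> 0" "f \<in> sections u" "ord (Q j) f = l"
    using weight_section[OF m j ul(1)] by metis
  have "Poly_Mapping.single u f \<noteq> 0" using f(1) by (metis lookup_single_eq lookup_zero)
  then have "Poly_Mapping.single u f \<in> A - {0}"
    using A_single f(2) ul(1) by (auto simp: weight_semigroup_iff)
  moreover have "val p q \<psi> (Q j) \<gamma> (Poly_Mapping.single u f) = g" using f ul(2) by (simp add: val_def)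
  ultimately show "g \<in> value_semigroup A (val p q \<psi> (Q j) \<gamma>)" unfolding value_semigroup_def by force
qed

lemma exists_interior_parameter:
  obtains c where "line_pt p q c \<notin> boundary"
proof -
  have "finite {c. line_pt p q c \<in> boundary}"
    using sum_points(2)[OF line _ boundary_on_line] by simp
  then show ?thesis using exists_outside_finite that by blast
qed


section \<open>Krull dimension and full rank\<close>

lemma sections_regular:
  assumes "line_pt p q c \<notin> boundary" "f \<in> sections u"
  shows "f \<in> regular_at c"
proof (cases "f = 0")
  case False
  have "0 \<le> ord (line_pt p q c) f"
    using sections_ordD(2)[OF assms(2) False] assms(1) by (simp add: proj_line_points)
  then show ?thesis using False by (simp add: regular_at_iff line_ord_line_pt[OF line])
qed (simp add: regular_at_0)

lemma A_regular:
  assumes "line_pt p q c \<notin> boundary" shows "A \<subseteq> coeffs_in (regular_at c)"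
proof
  fix f assume "f \<in> A"
  then have "Poly_Mapping.lookup f u \<in> regular_at c" for u
    using sections_regular[OF assms] regular_at_0 unfolding A_iff by metis
  then show "f \<in> coeffs_in (regular_at c)" by (simp add: coeffs_in_def)
qed

end

lemma coefficient_hom_ev_at: "coefficient_hom (regular_at c) (ev_at c)"
  by unfold_locales (auto simp: regular_at_0 regular_at_add regular_at_mult ev_at_0 ev_at_1 ev_at_add ev_at_mult)

lemma coefficient_hom_id: "coefficient_hom UNIV (\<lambda>x. x)"
  by unfold_locales auto

text \<open>The last \<open>n - i\<close> of the \<open>n\<close> rational coordinates \<open>x\<^sub>k(u)\<close>. They are collected in \<open>nat \<Rightarrow>\<^sub>0 rat\<close> because this
  is an ordered group, and therefore group algebras over it have no zero divisors.\<close>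

definition drop_coords :: "nat \<Rightarrow> nat \<Rightarrow> (nat \<Rightarrow> 'm \<Rightarrow> rat) \<Rightarrow> 'm \<Rightarrow> (nat \<Rightarrow>\<^sub>0 rat)" where
  "drop_coords n i x u = (\<Sum>k\<in>{i..<n}. Poly_Mapping.single k (x k u))"

lemma lookup_drop_coords:
  "Poly_Mapping.lookup (drop_coords n i x u) k = (if i \<le> k \<and> k < n then x k u else 0)"
  by (auto simp: drop_coords_def lookup_sum lookup_single when_def)

lemma drop_coords_add:
  "(\<And>k. k < n \<Longrightarrow> additive (x k)) \<Longrightarrow> drop_coords n i x (u + v) = drop_coords n i x u + drop_coords n i x v"
  by (rule poly_mapping_eqI) (simp add: lookup_drop_coords lookup_add additive_def)

lemma drop_coords_Suc:
  "drop_coords n (Suc i) x u = (\<lambda>a. a - Poly_Mapping.single i (Poly_Mapping.lookup a i)) (drop_coords n i x u)"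
  by (rule poly_mapping_eqI) (auto simp: lookup_drop_coords lookup_minus lookup_single when_def)

context divisor_on_line
begin

lemma primeideal_push_kernel:
  fixes \<phi> :: "'m \<Rightarrow> (nat \<Rightarrow>\<^sub>0 rat)" and h :: "'k poly fract \<Rightarrow> 'e::idom"
  assumes "coefficient_hom C h" "A \<subseteq> coeffs_in C" "\<And>u v. \<phi> (u + v) = \<phi> u + \<phi> v"
  shows "primeideal {f \<in> A. push \<phi> h f = 0} (subring_of_type A)"
proof -
  interpret coefficient_hom C h by fact
  have \<phi>0: "\<phi> 0 = 0" using assms(3)[of 0 0] by (metis add_0_right add_cancel_right_right)
  show ?thesis
    by (rule primeideal_kernel)
      (use A_0 A_1 A_add A_uminus A_mult push_1[of \<phi>] \<phi>0 push_add[of _ _ \<phi>] push_mult[of \<phi>] assms(2,3) in \<open>auto simp: subset_iff\<close>)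
qed

text \<open>Evaluate the coefficients at a general point \<open>c\<close> of the line, and then set the characters \<open>\<chi>\<close> of the weights
  \<open>\<beta>\<^sub>0, \<beta>\<^sub>1, \<dots>\<close> equal to \<open>1\<close>, one after the other. The kernels form a chain of primes. It grows at step \<open>i\<close>
  because a section \<open>s\<close> of weight \<open>\<beta>\<^sub>i\<close> has \<open>s(c) \<noteq> 0\<close>, and \<open>s \<chi> - s(c)\<close> is killed when
  \<open>\<chi>\<close> becomes \<open>1\<close> but not before. If some weight space contains sections of different orders at \<open>Q\<^sub>j\<close>, these are
  linearly independent, some combination vanishes at \<open>c\<close>, and the chain can be prolonged at the bottom by the kernel of
  the map that does not evaluate coefficients.\<close>

lemma krull_dim_A_ge:
  fixes x :: "nat \<Rightarrow> 'm \<Rightarrow> rat" and \<beta> :: "nat \<Rightarrow> 'm"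
  assumes m: "m \<ge> 1" and j: "j \<le> m"
    and \<beta>: "\<And>i. i < n \<Longrightarrow> \<beta> i \<in> fst ` weight_semigroup m \<sigma> \<Delta> j"
    and x: "\<And>k. k < n \<Longrightarrow> additive (x k)"
    and dual: "\<And>i k. i < n \<Longrightarrow> k < n \<Longrightarrow> x k (\<beta> i) = (if i = k then 1 else 0)"
  shows "enat n \<le> krull_dim (subring_of_type A)"
    and "(u, l) \<in> weight_semigroup m \<sigma> \<Delta> j \<Longrightarrow> (u, l') \<in> weight_semigroup m \<sigma> \<Delta> j \<Longrightarrow> l \<noteq> l' \<Longrightarrow>
      enat (Suc n) \<le> krull_dim (subring_of_type A)"
proof -
  obtain c where c: "line_pt p q c \<notin> boundary" by (rule exists_interior_parameter)
  interpret ev: coefficient_hom "regular_at c" "ev_at c" by (rule coefficient_hom_ev_at)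
  interpret Id: coefficient_hom UNIV "\<lambda>y :: 'k. y" by (rule coefficient_hom_id)
  define \<phi> where "\<phi> i = drop_coords n i x" for i
  have \<phi>_add: "\<phi> i (u + v) = \<phi> i u + \<phi> i v" for i u v
    unfolding \<phi>_def by (rule drop_coords_add[OF x])
  have \<phi>_0: "\<phi> i 0 = 0" for i using \<phi>_add[of i 0 0] by (metis add_0_right add_cancel_right_right)
  define P where "P i = {f \<in> A. push (\<phi> i) (ev_at c) f = 0}" for i
  define P0 where "P0 = {f \<in> A. push (\<phi> 0) (\<lambda>y. y) f = 0}"
  have prime: "primeideal (P i) (subring_of_type A)" for i
    unfolding P_def by (rule primeideal_push_kernel[OF coefficient_hom_ev_at A_regular[OF c] \<phi>_add])
  have prime0: "primeideal P0 (subring_of_type A)"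
    unfolding P0_def
    by (rule primeideal_push_kernel[OF coefficient_hom_id _ \<phi>_add]) (simp add: coeffs_in_def)
  have unit_section: "\<exists>s. s \<noteq> 0 \<and> s \<in> sections u \<and> ord (Q j) s = l \<and> ev_at c s \<noteq> 0 \<and> u \<in> dual_lattice_points \<sigma>"
    if ul: "(u, l) \<in> weight_semigroup m \<sigma> \<Delta> j" for u l
  proof -
    obtain s where s: "s \<noteq> 0" "s \<in> sections u" "ord (Q j) s = l"
      "\<And>P. P \<in> proj_line p q - boundary \<Longrightarrow> ord P s = 0"
      using weight_section[OF m j ul] by blast
    have "ord_at c s = 0" using s(4)[of "line_pt p q c"] c
      by (simp add: proj_line_points line_ord_line_pt[OF line])
    then have "ev_at c s \<noteq> 0" using ev_at_nonzero s(1) by blast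
    then show ?thesis using s ul by (auto simp: weight_semigroup_iff)
  qed
  have strict: "P i \<subset> P (Suc i)" if i: "i < n" for i
  proof
    let ?\<tau> = "\<lambda>a :: nat \<Rightarrow>\<^sub>0 rat. a - Poly_Mapping.single i (Poly_Mapping.lookup a i)"
    have "push (\<phi> (Suc i)) (ev_at c) f = push ?\<tau> (\<lambda>y. y) (push (\<phi> i) (ev_at c) f)" for f
      by (subst Id.push_push) (simp_all add: ev_at_0 \<phi>_def drop_coords_Suc[abs_def])
    then show "P i \<subseteq> P (Suc i)" by (auto simp: P_def)
    obtain l where l: "(\<beta> i, l) \<in> weight_semigroup m \<sigma> \<Delta> j" using \<beta>[OF i] by force
    obtain s where s: "s \<in> sections (\<beta> i)" "ev_at c s \<noteq> 0" "\<beta> i \<in> dual_lattice_points \<sigma>"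
      using unit_section[OF l] by blast
    define f where "f = Poly_Mapping.single (\<beta> i) s + Poly_Mapping.single 0 (const_fract (- ev_at c s))"
    have fA: "f \<in> A" unfolding f_def by (intro A_add A_single A_const s)
    have "const_fract (- ev_at c s) \<in> regular_at c"
      using sections_regular[OF c const_in_sections] .
    moreover have "s \<in> regular_at c" using sections_regular[OF c s(1)] .
    ultimately have f: "push (\<phi> k) (ev_at c) f
        = Poly_Mapping.single (\<phi> k (\<beta> i)) (ev_at c s) + Poly_Mapping.single 0 (- ev_at c s)" for k
      unfolding f_def
      by (simp add: ev.push_add ev.coeffs_in_single push_single ev_at_0 ev_at_const \<phi>_0)
    have "\<phi> (Suc i) (\<beta> i) = 0"
      by (rule poly_mapping_eqI) (use i dual in \<open>auto simp: \<phi>_def lookup_drop_coords\<close>)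
    then have "f \<in> P (Suc i)" using fA by (simp add: P_def f flip: single_add)
    moreover have "f \<notin> P i"
    proof -
      have "Poly_Mapping.lookup (\<phi> i (\<beta> i)) i = 1" using i dual by (simp add: \<phi>_def lookup_drop_coords)
      then have "\<phi> i (\<beta> i) \<noteq> 0" by force
      then have "Poly_Mapping.lookup (push (\<phi> i) (ev_at c) f) 0 = - ev_at c s"
        by (simp add: f lookup_add lookup_single)
      then show ?thesis using s(2) by (auto simp: P_def)
    qed
    ultimately show "P i \<noteq> P (Suc i)" by blast
  qed
  show "enat n \<le> krull_dim (subring_of_type A)"
    by (rule krull_dim_ge[of n P]) (use prime strict in auto)
  assume ul: "(u, l) \<in> weight_semigroup m \<sigma> \<Delta> j" and ul': "(u, l') \<in> weight_semigroup m \<sigma> \<Delta> j"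
    and ll': "l \<noteq> l'"
  have strict0: "P0 \<subset> P 0"
  proof
    show "P0 \<subseteq> P 0"
    proof
      fix f assume f: "f \<in> P0"
      then have "f \<in> coeffs_in (regular_at c)" using A_regular[OF c] by (auto simp: P0_def)
      then have "push (\<phi> 0) (ev_at c) f = push (\<lambda>a. a) (ev_at c) (push (\<phi> 0) (\<lambda>y. y) f)"
        by (subst ev.push_push) (simp_all add: coeffs_in_def)
      then show "f \<in> P 0" using f by (simp add: P_def P0_def)
    qed
    obtain s where s: "s \<noteq> 0" "s \<in> sections u" "ord (Q j) s = l" "ev_at c s \<noteq> 0" and u: "u \<in> dual_lattice_points \<sigma>"
      using unit_section[OF ul] by blast
    obtain s' where s': "s' \<noteq> 0" "s' \<in> sections u" "ord (Q j) s' = l'" "ev_at c s' \<noteq> 0"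
      using unit_section[OF ul'] by blast
    \<comment> \<open>Constant multiples whose values at \<open>c\<close> cancel; their orders at \<open>Q\<^sub>j\<close> differ, so they do not cancel themselves.\<close>
    define g where "g = const_fract (ev_at c s') * s"
    define g' where "g' = const_fract (- ev_at c s) * s'"
    have sec: "g \<in> sections u" "g' \<in> sections u"
      using sections_mult[OF dual_lattice_points_0[OF cone] u const_in_sections] s(2) s'(2)
      by (simp_all add: g_def g'_def)
    interpret w: discrete_valuation "ord (Q j)" by (rule discrete_valuation_line_ord)
    have nz: "g \<noteq> 0" "g' \<noteq> 0" using s s' by (auto simp: g_def g'_def const_fract_0_iff)
    have "ord (Q j) g = l" "ord (Q j) g' = l'"
      using s s' by (simp_all add: g_def g'_def w.val_mult const_fract_0_iff line_ord_const)
    then have "ord (Q j) g \<noteq> ord (Q j) (- g')" using ll' w.val_mult[of "-1" g'] w.val_mult[of "-1" "-1"] w.val_one nz by simp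
    then have ne: "g + g' \<noteq> 0" by (auto simp: add_eq_0_iff2)
    have reg: "const_fract k \<in> regular_at c" "s \<in> regular_at c" "s' \<in> regular_at c" for k
      using sections_regular[OF c] const_in_sections s(2) s'(2) by blast+
    then have reg': "g \<in> regular_at c" "g' \<in> regular_at c" unfolding g_def g'_def
      by (auto intro: regular_at_mult)
    have "ev_at c (g + g') = 0"
      unfolding ev_at_add[OF reg'] using reg by (simp add: g_def g'_def ev_at_mult ev_at_const)
    then have "Poly_Mapping.single u (g + g') \<in> P 0"
      using A_single[OF u sections_add[OF sec]] by (simp add: P_def push_single ev_at_0)
    moreover have "Poly_Mapping.single u (g + g') \<notin> P0"
    proof
      assume "Poly_Mapping.single u (g + g') \<in> P0"
      then have "Poly_Mapping.single (\<phi> 0 u) (g + g') = 0" by (simp add: P0_def push_single)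
      then have "g + g' = 0" by (metis lookup_single_eq lookup_zero)
      then show False using ne by simp
    qed
    ultimately show "P0 \<noteq> P 0" by blast
  qed
  show "enat (Suc n) \<le> krull_dim (subring_of_type A)"
    by (rule krull_dim_ge[of "Suc n" "\<lambda>i. case i of 0 \<Rightarrow> P0 | Suc i \<Rightarrow> P i"])
      (use prime prime0 strict strict0 in \<open>auto split: nat.split\<close>)
qed

text \<open>Let \<open>n\<close> be the rank of the group generated by the weights of \<open>A\<close>. If some weight \<open>u\<close> occurs in two pairs
  \<open>(u, l)\<close>, \<open>(u, l')\<close> of \<open>W\<close>, then \<open>W\<close> has rank at most \<open>n + 1\<close> and \<open>A\<close> has dimension at least \<open>n + 1\<close>.
  Otherwise the projection to \<open>M\<close> is injective on the group generated by \<open>W\<close>, and the same holds with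
  \<open>n\<close> in place of \<open>n + 1\<close>. In both cases the dimension is at least the rank of \<open>W\<close>, and a nontrivial
  kernel of \<open>\<rho>\<close> would make the rank of the image smaller.\<close>

lemma inj_on_if_krull_dim_le_rank:
  fixes \<rho> :: "'m \<times> int \<Rightarrow> 'g::ab_group_add" and j :: nat
  defines "W \<equiv> weight_semigroup m \<sigma> \<Delta> j"
  assumes M_free: "fg_free TYPE('m)" and m: "m \<ge> 1" and j: "j \<le> m"
    and \<rho>: "additive \<rho>"
    and rank: "krull_dim (subring_of_type A) \<le> group_rank (zm.span (\<rho> ` W))"
  shows "inj_on \<rho> W"
proof (rule inj_onI, rule ccontr)
  fix a b assume ab: "a \<in> W" "b \<in> W" "\<rho> a = \<rho> b" "a \<noteq> b"
  define d where "d = a - b"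
  have "d \<in> zm.span W" unfolding d_def by (intro zm.span_diff zm.span_base ab)
  moreover have "\<rho> d = 0" unfolding d_def additive.diff[OF \<rho>] using ab by simp
  ultimately have d: "d \<in> zm.span W" "d \<noteq> 0" "\<rho> d = 0" using ab by (simp_all add: d_def)
  define U where "U = fst ` W"
  obtain \<iota> :: "'m \<Rightarrow> 'm option \<Rightarrow> rat" and S where \<iota>: "additive \<iota>" "inj \<iota>" "finite S"
    "\<And>u z. z \<notin> S \<Longrightarrow> \<iota> u z = 0" "\<And>u. \<iota> u None = 0"
    using lattice_embedding[OF M_free] by blast
  \<comment> \<open>A basis consisting of weights of \<open>A\<close>, not merely of differences of weights.\<close>
  obtain B where B: "B \<subseteq> \<iota> ` U" "\<not> ratfun.dependent B" "\<iota> ` U \<subseteq> ratfun.span B"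
    using ratfun.maximal_independent_subset[of "\<iota> ` U"] by blast
  have "B \<subseteq> ratfun.span (unit_fun ` S)"
  proof
    fix f assume "f \<in> B"
    then obtain u where "f = \<iota> u" using B(1) by blast
    then show "f \<in> ratfun.span (unit_fun ` S)" using ratfun_span_finite_support[OF \<iota>(3)] \<iota>(4) by blast
  qed
  then have finB: "finite B" using ratfun.independent_span_bound[OF _ B(2)] \<iota>(3) by blast
  define n where "n = card B"
  obtain b where b: "bij_betw b {..<n} B"
    using ex_bij_betw_nat_finite[OF finB] by (auto simp: n_def atLeast0LessThan)
  have bB: "b i \<in> B" if "i < n" for i using b that by (auto simp: bij_betw_def)
  then have "\<forall>i. \<exists>u. i < n \<longrightarrow> u \<in> U \<and> b i = \<iota> u" using B(1) by blast
  then obtain \<beta> where \<beta>: "\<And>i. i < n \<Longrightarrow> \<beta> i \<in> U" "\<And>i. i < n \<Longrightarrow> b i = \<iota> (\<beta> i)" by metis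
  \<comment> \<open>Coordinates on the whole space, so that the dual functionals are additive on all of \<open>M\<close>.\<close>
  define E where "E = ratfun.extend_basis B"
  have E: "\<not> ratfun.dependent E" "ratfun.span E = UNIV" "B \<subseteq> E"
    using ratfun.independent_extend_basis[OF B(2)] ratfun.span_extend_basis[OF B(2)]
      ratfun.extend_basis_superset[OF B(2)] by (simp_all add: E_def)
  define x where "x k u = ratfun.representation E (\<iota> u) (b k)" for k u
  have x: "additive (x k)" for k
    unfolding additive_def x_def additive.add[OF \<iota>(1)]
    using ratfun.representation_add[OF E(1)] E(2) by simp
  have dual: "x k (\<beta> i) = (if i = k then 1 else 0)" if "i < n" "k < n" for i k
  proof -
    have "b i \<in> E" using bB[OF that(1)] E(3) by blast
    moreover have "b i = b k \<longleftrightarrow> i = k" using b that by (auto simp: bij_betw_def inj_on_def)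
    ultimately show ?thesis
      using ratfun.representation_basis[OF E(1), of "b i"] by (auto simp: x_def \<beta>(2)[OF that(1), symmetric])
  qed
  have dim: "enat n \<le> krull_dim (subring_of_type A)"
    "\<And>u l l'. (u, l) \<in> W \<Longrightarrow> (u, l') \<in> W \<Longrightarrow> l \<noteq> l' \<Longrightarrow> enat (Suc n) \<le> krull_dim (subring_of_type A)"
    using krull_dim_A_ge[OF m j, of n \<beta> x] \<beta>(1) x dual unfolding U_def W_def by blast+
  show False
  proof (cases "\<exists>u l l'. (u, l) \<in> W \<and> (u, l') \<in> W \<and> l \<noteq> l'")
    case True
    \<comment> \<open>Two values over one weight: the integer component needs a coordinate of its own.\<close>
    define \<theta> where "\<theta> = (\<lambda>(u, l). \<iota> u + (\<lambda>z. of_int l * unit_fun None z))"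
    have \<theta>: "additive \<theta>"
      using additive.add[OF \<iota>(1)] by (auto simp: additive_def \<theta>_def fun_eq_iff algebra_simps)
    have "inj \<theta>"
    proof (rule injI, clarify)
      fix u l u' l' assume eq: "\<theta> (u, l) = \<theta> (u', l')"
      have at_None: "\<theta> (w, k) None = of_int k" for w k by (simp add: \<theta>_def \<iota>(5) unit_fun_def)
      have "l = l'" using fun_cong[OF eq, of None] unfolding at_None by simp
      then show "u = u' \<and> l = l'" using eq \<iota>(2) by (auto simp: \<theta>_def inj_def)
    qed
    let ?T = "insert (unit_fun None) B"
    have "\<theta> ` W \<subseteq> ratfun.span ?T"
    proof (rule image_subsetI, clarify)
      fix u l assume "(u, l) \<in> W"
      then have "\<iota> u \<in> ratfun.span B" using B(3) by (force simp: U_def)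
      then have "\<iota> u \<in> ratfun.span ?T" using ratfun.span_mono[of B ?T] by blast
      then show "\<theta> (u, l) \<in> ratfun.span ?T"
        unfolding \<theta>_def by (auto intro!: ratfun.span_add ratfun.span_scale intro: ratfun.span_base)
    qed
    then have "group_rank (zm.span (\<rho> ` W)) < enat (card ?T)"
      using group_rank_image_less[OF \<theta> _ _ _ \<rho> d, of ?T] \<open>inj \<theta>\<close> finB inj_on_subset by blast
    also have "\<dots> \<le> enat (Suc n)" using finB by (simp add: n_def card_insert_if)
    also have "\<dots> \<le> krull_dim (subring_of_type A)" using True dim(2) by blast
    finally show False using rank by simp
  next
    case False
    \<comment> \<open>At most one value over each weight: the first component alone determines the pair.\<close>
    define \<theta> where "\<theta> w = \<iota> (fst w)" for w :: "'m \<times> int"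
    have \<theta>: "additive \<theta>" using additive.add[OF \<iota>(1)] by (auto simp: additive_def \<theta>_def)
    have W: "0 \<in> W" "\<And>v w. v \<in> W \<Longrightarrow> w \<in> W \<Longrightarrow> v + w \<in> W"
      using weight_semigroup_0 weight_semigroup_add j by (auto simp: W_def)
    have "inj_on \<theta> (zm.span W)"
    proof (rule inj_onI)
      fix v w assume vw: "v \<in> zm.span W" "w \<in> zm.span W" "\<theta> v = \<theta> w"
      obtain v1 v2 where v: "v1 \<in> W" "v2 \<in> W" "v = v1 - v2"
        using span_of_additive_submonoid[OF W vw(1)] by blast
      obtain w1 w2 where w: "w1 \<in> W" "w2 \<in> W" "w = w1 - w2"
        using span_of_additive_submonoid[OF W vw(2)] by blast
      have fst_eq: "fst (v1 + w2) = fst (w1 + v2)"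
        using injD[OF \<iota>(2), of "fst v" "fst w"] vw(3) v(3) w(3) by (simp add: \<theta>_def algebra_simps)
      have "v1 + w2 \<in> W" "w1 + v2 \<in> W" using W(2) v w by auto
      then have "snd (v1 + w2) = snd (w1 + v2)" using False fst_eq by (metis prod.collapse)
      then have "v1 + w2 = w1 + v2" using fst_eq by (simp add: prod_eq_iff)
      then show "v = w" unfolding v(3) w(3) by (simp add: diff_eq_eq diff_add_eq eq_diff_eq)
    qed
    moreover have "\<theta> ` W \<subseteq> ratfun.span B" using B(3) by (auto simp: \<theta>_def U_def)
    ultimately have "group_rank (zm.span (\<rho> ` W)) < enat n"
      using group_rank_image_less[OF \<theta> _ finB _ \<rho> d] unfolding n_def by blast
    then show False using rank dim(1) by simp
  qed
qed

end

theorem corollary5p5: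
  fixes m j :: nat
    and \<sigma> :: "('m::ab_group_add \<Rightarrow> rat) set"
    and \<Delta> :: "nat \<Rightarrow> ('m \<Rightarrow> rat) set"
    and p q :: "nat \<Rightarrow> 'k::alg_closed_field"
    and L :: "(nat \<Rightarrow> 'k) set set"
    and Q :: "nat \<Rightarrow> (nat \<Rightarrow> 'k) set"
    and \<psi> :: "'m \<Rightarrow> 'g::linordered_ab_group_add"
    and \<gamma> :: 'g
    and R :: "('m \<Rightarrow>\<^sub>0 'k poly fract) set"
    and v :: "('m \<Rightarrow>\<^sub>0 'k poly fract) \<Rightarrow> 'g"
  assumes M_free: "fg_free TYPE('m)"
    and m: "m \<ge> 1"
    and \<sigma>: "polyhedral_cone \<sigma>" "pointed \<sigma>"
    and \<Delta>: "\<And>i. i \<le> m \<Longrightarrow> \<Delta> i = {} \<or> (polyhedron_in_NQ (\<Delta> i) \<and> tailcone (\<Delta> i) = \<sigma>)"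
    and \<Delta>_sum: "minkowski_sum m \<Delta> \<subset> \<sigma>"
    and L: "spans_line m p q" "L = proj_line p q"
    and L_torus: "L \<inter> dense_torus m \<noteq> {}"
    and Q: "\<And>i. i \<le> m \<Longrightarrow> hyperplane m i \<inter> L = {Q i}"
    and Q_distinct: "inj_on Q {..m}"
    and R: "R = RX m \<sigma> \<Delta> p q Q"
    and \<Gamma>_free: "fg_free TYPE('g)"
    and \<psi>: "additive \<psi>"
    and \<gamma>: "\<gamma> \<ge> 0"
    and j: "j \<le> m"
    and v: "v = val p q \<psi> (Q j) \<gamma>"
  shows "value_semigroup R v = (\<lambda>(u, l). \<psi> u + zmul l \<gamma>) ` weight_semigroup m \<sigma> \<Delta> j \<and>
    (full_rank R v \<longrightarrow>
       add_monoid_on (value_semigroup R v) \<cong> add_monoid_on (weight_semigroup m \<sigma> \<Delta> j))"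
proof -
  have "\<sigma> \<subseteq> NQ" using \<sigma>(1) by (auto simp: polyhedral_cone_def)
  moreover have "Q i \<in> proj_line p q" if "i \<le> m" for i using Q[OF that] L(2) by blast
  ultimately interpret divisor_on_line m \<sigma> \<Delta> p q Q
    by unfold_locales (use \<Delta> L(1) Q_distinct in auto)
  let ?\<rho> = "\<lambda>(u, l). \<psi> u + zmul l \<gamma>" and ?W = "weight_semigroup m \<sigma> \<Delta> j"
  have value_eq: "value_semigroup R v = ?\<rho> ` ?W"
    unfolding R v by (rule value_semigroup_eq[OF m j])
  have \<rho>: "additive ?\<rho>"
    using additive.add[OF \<psi>] by (auto simp: additive_def zmul_add_left algebra_simps)
  have "add_monoid_on (?\<rho> ` ?W) \<cong> add_monoid_on ?W" if full: "full_rank R v"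
  proof (rule add_monoid_on_image_iso[OF \<rho>])
    have "group_rank (zm.span (?\<rho> ` ?W)) = krull_dim (subring_of_type A)"
      using full unfolding full_rank_def value_eq unfolding R .
    then show "inj_on ?\<rho> ?W" by (intro inj_on_if_krull_dim_le_rank[OF M_free m j \<rho>]) simp
  qed (rule weight_semigroup_add[OF _ _ j])
  then show ?thesis using value_eq by simp
qed

end
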